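(* Let $\mathcal{I}$ be any one of $\mathcal{P}$, $\mathcal{P}_\infty$, $\mathcal{B}$. The isometry classes $\{\mu\in\mathcal{I}: X_\mu$ is LOH$\}$ and $\{\mu\in\mathcal{I}: X_\mu$ is OH$\}$ are $G_\delta$-complete in $\mathcal{I}$.
   Context: Coding: $V$ is the set of finitely supported rational sequences; $\mathcal{P}\subset\mathbb{R}^V$ the seminorms on $V$ with pointwise convergence topology; for $\mu\in\mathcal{P}$, $\bar\mu$ is its seminorm extension to $c_{00}$ and $X_\mu$ the completion of $c_{00}/\{\bar\mu=0\}$; $\mathcal{P}_\infty=\{\mu:\dim X_\mu=\infty\}$, $\mathcal{B}=\{\mu\in\mathcal{P}_\infty:\bar\mu$ a norm on $c_{00}\}$, subspace topologies. LOH: for every $\varepsilon>0$ and $x\in X$ there is $y\in S_X$ with $\|tx+y\|\ge(1-\varepsilon)(|t|\|x\|+\|y\|)$ for all $t\in\mathbb{R}$. OH: for every finite-dimensional subspace $E\subset X$ and $\varepsilon>0$ there is $y\in S_X$ with $\|x+y\|\ge(1-\varepsilon)(\|x\|+\|y\|)$ for all $x\in E$. A set $A$ in a Polish space $Z$ is $G_\delta$-complete if it is $G_\delta$ and every $G_\delta$ subset of every zero-dimensional Polish space is a continuous preimage of $A$. *)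

theory Defs
  imports "HOL-Analysis.Analysis"
begin

definition Polish_space :: "'a topology \<Rightarrow> bool" where
  "Polish_space X \<longleftrightarrow> completely_metrizable_space X \<and> separable_space X"

definition zero_dimensional :: "'a topology \<Rightarrow> bool" where
  "zero_dimensional X \<longleftrightarrow>
     (\<forall>U x. openin X U \<and> x \<in> U \<longrightarrow>
        (\<exists>C. openin X C \<and> closedin X C \<and> x \<in> C \<and> C \<subseteq> U))"

text \<open>G-delta completeness of A in Z.  Quantification over "every zero-dimensional
  Polish space" is over all such spaces carried by the type 'w (the theorem is
  stated for an arbitrary type 'w).\<close>
definition Gdelta_complete_in :: "'w itself \<Rightarrow> 'a topology \<Rightarrow> 'a set \<Rightarrow> bool" where
  "Gdelta_complete_in (_ :: 'w itself) Z A \<longleftrightarrow>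
     gdelta_in Z A \<and>
     (\<forall>(W :: 'w topology) B. Polish_space W \<and> zero_dimensional W \<and> gdelta_in W B \<longrightarrow>
        (\<exists>f. continuous_map W Z f \<and> B = {w \<in> topspace W. f w \<in> A}))"

definition Vset :: "(nat \<Rightarrow> rat) set" where
  "Vset = {q. finite {i. q i \<noteq> 0}}"

definition c00 :: "(nat \<Rightarrow> real) set" where
  "c00 = {x. finite {i. x i \<noteq> 0}}"

definition RV :: "((nat \<Rightarrow> rat) \<Rightarrow> real) topology" where
  "RV = product_topology (\<lambda>_. euclideanreal) Vset"

definition seminorm_V :: "((nat \<Rightarrow> rat) \<Rightarrow> real) \<Rightarrow> bool" where
  "seminorm_V \<mu> \<longleftrightarrow>
     (\<forall>q\<in>Vset. \<forall>r\<in>Vset. \<mu> (\<lambda>i. q i + r i) \<le> \<mu> q + \<mu> r) \<and>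
     (\<forall>a::rat. \<forall>q\<in>Vset. \<mu> (\<lambda>i. a * q i) = \<bar>of_rat a\<bar> * \<mu> q)"

definition Pset :: "((nat \<Rightarrow> rat) \<Rightarrow> real) set" where
  "Pset = {\<mu> \<in> topspace RV. seminorm_V \<mu>}"

text \<open>The (unique continuous) seminorm extension of mu to c00: the limit of mu q
  as q ranges over rational vectors supported in supp x converging to x.\<close>
definition mu_bar :: "((nat \<Rightarrow> rat) \<Rightarrow> real) \<Rightarrow> (nat \<Rightarrow> real) \<Rightarrow> real" where
  "mu_bar \<mu> x = (THE r. \<forall>\<epsilon>>0. \<exists>\<delta>>0. \<forall>q\<in>Vset.
      {i. q i \<noteq> 0} \<subseteq> {i. x i \<noteq> 0} \<and>
      (\<Sum>i\<in>{i. x i \<noteq> 0}. \<bar>x i - of_rat (q i)\<bar>) < \<delta> \<longrightarrow> \<bar>\<mu> q - r\<bar> < \<epsilon>)"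

definition mu_cauchy :: "((nat \<Rightarrow> rat) \<Rightarrow> real) \<Rightarrow> (nat \<Rightarrow> nat \<Rightarrow> real) \<Rightarrow> bool" where
  "mu_cauchy \<mu> s \<longleftrightarrow> (\<forall>n. s n \<in> c00) \<and>
     (\<forall>\<epsilon>>0. \<exists>N. \<forall>m\<ge>N. \<forall>n\<ge>N. mu_bar \<mu> (\<lambda>i. s m i - s n i) < \<epsilon>)"

definition mu_rel :: "((nat \<Rightarrow> rat) \<Rightarrow> real) \<Rightarrow> ((nat \<Rightarrow> nat \<Rightarrow> real) \<times> (nat \<Rightarrow> nat \<Rightarrow> real)) set" where
  "mu_rel \<mu> = {(s, t). mu_cauchy \<mu> s \<and> mu_cauchy \<mu> t \<and>
                       (\<lambda>n. mu_bar \<mu> (\<lambda>i. s n i - t n i)) \<longlonglongrightarrow> 0}"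

definition Xmu :: "((nat \<Rightarrow> rat) \<Rightarrow> real) \<Rightarrow> (nat \<Rightarrow> nat \<Rightarrow> real) set set" where
  "Xmu \<mu> = {s. mu_cauchy \<mu> s} // mu_rel \<mu>"

definition rep :: "(nat \<Rightarrow> nat \<Rightarrow> real) set \<Rightarrow> nat \<Rightarrow> nat \<Rightarrow> real" where
  "rep C = (SOME s. s \<in> C)"

definition xnorm :: "((nat \<Rightarrow> rat) \<Rightarrow> real) \<Rightarrow> (nat \<Rightarrow> nat \<Rightarrow> real) set \<Rightarrow> real" where
  "xnorm \<mu> C = lim (\<lambda>n. mu_bar \<mu> (rep C n))"

definition xzero :: "((nat \<Rightarrow> rat) \<Rightarrow> real) \<Rightarrow> (nat \<Rightarrow> nat \<Rightarrow> real) set" where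
  "xzero \<mu> = mu_rel \<mu> `` {\<lambda>n i. 0}"

definition xadd :: "((nat \<Rightarrow> rat) \<Rightarrow> real) \<Rightarrow> (nat \<Rightarrow> nat \<Rightarrow> real) set
                    \<Rightarrow> (nat \<Rightarrow> nat \<Rightarrow> real) set \<Rightarrow> (nat \<Rightarrow> nat \<Rightarrow> real) set" where
  "xadd \<mu> C D = mu_rel \<mu> `` {\<lambda>n i. rep C n i + rep D n i}"

definition xscale :: "((nat \<Rightarrow> rat) \<Rightarrow> real) \<Rightarrow> real
                    \<Rightarrow> (nat \<Rightarrow> nat \<Rightarrow> real) set \<Rightarrow> (nat \<Rightarrow> nat \<Rightarrow> real) set" where
  "xscale \<mu> a C = mu_rel \<mu> `` {\<lambda>n i. a * rep C n i}"

primrec xsum :: "((nat \<Rightarrow> rat) \<Rightarrow> real) \<Rightarrow> nat \<Rightarrow> (nat \<Rightarrow> real)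
                 \<Rightarrow> (nat \<Rightarrow> (nat \<Rightarrow> nat \<Rightarrow> real) set) \<Rightarrow> (nat \<Rightarrow> nat \<Rightarrow> real) set" where
  "xsum \<mu> 0 c e = xzero \<mu>"
| "xsum \<mu> (Suc n) c e = xadd \<mu> (xsum \<mu> n c e) (xscale \<mu> (c n) (e n))"

definition infinite_dim :: "((nat \<Rightarrow> rat) \<Rightarrow> real) \<Rightarrow> bool" where
  "infinite_dim \<mu> \<longleftrightarrow> (\<forall>n. \<exists>e. (\<forall>i<n. e i \<in> Xmu \<mu>) \<and>
      (\<forall>c. xsum \<mu> n c e = xzero \<mu> \<longrightarrow> (\<forall>i<n. c i = 0)))"

definition Pinf :: "((nat \<Rightarrow> rat) \<Rightarrow> real) set" where
  "Pinf = {\<mu> \<in> Pset. infinite_dim \<mu>}"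

definition Bset :: "((nat \<Rightarrow> rat) \<Rightarrow> real) set" where
  "Bset = {\<mu> \<in> Pinf. \<forall>x\<in>c00. mu_bar \<mu> x = 0 \<longrightarrow> x = (\<lambda>i. 0)}"

definition LOH :: "((nat \<Rightarrow> rat) \<Rightarrow> real) \<Rightarrow> bool" where
  "LOH \<mu> \<longleftrightarrow> (\<forall>\<epsilon>>0. \<forall>x\<in>Xmu \<mu>. \<exists>y\<in>Xmu \<mu>. xnorm \<mu> y = 1 \<and>
      (\<forall>t::real. xnorm \<mu> (xadd \<mu> (xscale \<mu> t x) y)
                   \<ge> (1 - \<epsilon>) * (\<bar>t\<bar> * xnorm \<mu> x + xnorm \<mu> y)))"

text \<open>Finite-dimensional subspaces E are exactly the spans of finite families
  e_0, ..., e_(n-1) of X_mu.\<close>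
definition OH :: "((nat \<Rightarrow> rat) \<Rightarrow> real) \<Rightarrow> bool" where
  "OH \<mu> \<longleftrightarrow> (\<forall>\<epsilon>>0. \<forall>n e. (\<forall>i<n. e i \<in> Xmu \<mu>) \<longrightarrow>
      (\<exists>y\<in>Xmu \<mu>. xnorm \<mu> y = 1 \<and>
        (\<forall>c. xnorm \<mu> (xadd \<mu> (xsum \<mu> n c e) y)
               \<ge> (1 - \<epsilon>) * (xnorm \<mu> (xsum \<mu> n c e) + xnorm \<mu> y))))"

end

theory Submission
  imports Defs "HOL-Library.Function_Algebras"
begin

text \<open>
  LOH is the restriction of OH to one-dimensional subspaces. For every \<open>n\<close>, octahedrality for
  \<open>n\<close>-dimensional subspaces only has to be tested on finite sets of rational vectors: a ball in a
  finite-dimensional space is totally bounded, and for \<open>x\<close> of large norm the inequality follows from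
  the triangle inequality. Each such finite test is an open condition on \<open>\<mu>\<close>, and there are
  countably many tests, so both classes are \<open>G\<^sub>\<delta>\<close>.

  For hardness, a \<open>G\<^sub>\<delta>\<close> set in a zero-dimensional Polish space consists of the points lying in
  infinitely many members of a sequence of clopen sets \<open>C\<^sub>k\<close>. Given a point \<open>w\<close>, let \<open>A\<close> be the set of
  those \<open>k\<close> with \<open>w \<in> C\<^sub>k\<close>, and norm \<open>c\<^sub>0\<^sub>0\<close> by the sum norm on the coordinates in \<open>A\<close> plus the supremum
  norm on the remaining ones. The value at a fixed vector depends on finitely many \<open>C\<^sub>k\<close> only, hence
  continuously on \<open>w\<close>. If \<open>A\<close> is infinite, unit vectors far out in \<open>A\<close> witness OH; if \<open>A\<close> is finite,
  LOH fails.
\<close>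

text \<open>Octahedrality speaks about real subspaces of a completion whose elements are classes
  with representatives picked by \<open>SOME\<close>. To avoid both, the argument lives on the space
  of Cauchy sequences with its seminorm, where no quotient is taken and the constant rational
  sequences are dense. The price is a kernel, so boundedness of a combination does not bound its
  coefficients. The bound on the dimension has to survive the approximation, because it is what
  separates LOH from OH. Hence spanning vectors and coefficients are approximated separately, and
  every test set lies in the span of n rational vectors. The coding norm is that of an l_1-sum of
  l_1 over A and c_0 over the complement. It is a norm on \<open>c00\<close> for every A, so the
  codes lie in \<open>Bset\<close>, the smallest of the three spaces, and one map serves all of
  them. It also serves both classes: infinite A gives octahedrality in every dimension, finite A
  destroys it already in dimension one.\<close>

instantiation "fun" :: (type, real_vector) real_vector
begin

definition scaleR_fun :: "real \<Rightarrow> ('a \<Rightarrow> 'b) \<Rightarrow> 'a \<Rightarrow> 'b" where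
  "scaleR_fun a f = (\<lambda>x. a *\<^sub>R f x)"

instance
  by standard (auto simp: scaleR_fun_def fun_eq_iff algebra_simps)

end

lemma scaleR_fun_apply [simp]: "(a *\<^sub>R f) x = a *\<^sub>R f x"
  by (simp add: scaleR_fun_def)

lemma sum_fun_apply: "(\<Sum>i\<in>A. f i) x = (\<Sum>i\<in>A. f i x)"
  by (induction A rule: infinite_finite_induct) auto

definition lincomb :: "nat \<Rightarrow> (nat \<Rightarrow> real) \<Rightarrow> (nat \<Rightarrow> 'a::real_vector) \<Rightarrow> 'a" where
  "lincomb n c e = (\<Sum>i<n. c i *\<^sub>R e i)"

lemma lincomb_Suc: "lincomb (Suc n) c e = lincomb n c e + c n *\<^sub>R e n"
  by (simp add: lincomb_def)

lemma lincomb_add_scale: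
  "lincomb n (\<lambda>i. c i + a * d i) e = lincomb n c e + a *\<^sub>R lincomb n d e"
  by (simp add: lincomb_def algebra_simps sum.distrib scaleR_sum_right)

lemma lincomb_upd: "lincomb n (c(n := a)) e = lincomb n c e"
  by (simp add: lincomb_def)

section \<open>Octahedrality in seminormed spaces\<close>

text \<open>The carrier is a subset of a vector space so that \<open>c00\<close> and the space of
  Cauchy sequences fit directly, with the pointwise operations on functions. Definiteness is not
  assumed, since kernels are never divided out here.\<close>

locale seminormed =
  fixes S :: "'a::real_vector set" and p :: "'a \<Rightarrow> real"
  assumes subspace: "subspace S"
    and triangle: "\<And>x y. x \<in> S \<Longrightarrow> y \<in> S \<Longrightarrow> p (x + y) \<le> p x + p y"
    and scale: "\<And>a x. x \<in> S \<Longrightarrow> p (a *\<^sub>R x) = \<bar>a\<bar> * p x"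
begin

lemma p_zero [simp]: "p 0 = 0"
  using scale[of 0 0] subspace by (simp add: subspace_0)

lemma p_minus [simp]: "x \<in> S \<Longrightarrow> p (- x) = p x"
  using scale[of x "-1"] by simp

lemma p_nonneg: "x \<in> S \<Longrightarrow> 0 \<le> p x"
  using triangle[of x "- x"] subspace by (simp add: subspace_neg)

lemma p_diff_commute: "x \<in> S \<Longrightarrow> y \<in> S \<Longrightarrow> p (x - y) = p (y - x)"
  using p_minus[of "x - y"] subspace by (simp add: subspace_diff)

lemma p_diff_le: "x \<in> S \<Longrightarrow> y \<in> S \<Longrightarrow> p x - p y \<le> p (x - y)"
  using triangle[of "x - y" y] subspace by (simp add: subspace_diff)

lemma p_abs_diff_le: "x \<in> S \<Longrightarrow> y \<in> S \<Longrightarrow> \<bar>p x - p y\<bar> \<le> p (x - y)"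
  using p_diff_le[of x y] p_diff_le[of y x] p_diff_commute[of x y] by linarith

lemma p_triangle_diff:
  "x \<in> S \<Longrightarrow> y \<in> S \<Longrightarrow> z \<in> S \<Longrightarrow> p (x - z) \<le> p (x - y) + p (y - z)"
  using triangle[of "x - y" "y - z"] subspace by (simp add: subspace_diff)

lemma p_sum_le: "(\<And>i. i \<in> A \<Longrightarrow> f i \<in> S) \<Longrightarrow> p (\<Sum>i\<in>A. f i) \<le> (\<Sum>i\<in>A. p (f i))"
proof (induction A rule: infinite_finite_induct)
  case (insert x A)
  then have "p (f x + sum f A) \<le> p (f x) + p (sum f A)"
    using subspace by (intro triangle) (auto intro: subspace_sum)
  with insert show ?case by auto
qed auto

lemma lincomb_in: "(\<And>i. i < n \<Longrightarrow> e i \<in> S) \<Longrightarrow> lincomb n c e \<in> S"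
  unfolding lincomb_def using subspace by (auto intro!: subspace_sum subspace_scale)

text \<open>The coefficients need not be bounded when the vectors are dependent modulo the kernel
  of the seminorm, so the induction distinguishes whether the last vector has positive distance
  from the span of the others.\<close>
lemma lincomb_ball_totally_bounded:
  assumes "\<And>i. i < n \<Longrightarrow> e i \<in> S" and "0 < \<delta>"
  shows "\<exists>F. finite F \<and> (\<forall>c. p (lincomb n c e) \<le> M \<longrightarrow>
           (\<exists>f\<in>F. p (lincomb n c e - lincomb n f e) < \<delta>))"
  using assms
proof (induction n arbitrary: M \<delta>)
  case 0
  then show ?case by (intro exI[of _ "{\<lambda>_. 0}"]) (simp add: lincomb_def)
next
  case (Suc n)
  have eS: "\<And>i. i < n \<Longrightarrow> e i \<in> S" and en: "e n \<in> S" using Suc.prems by auto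
  note L = lincomb_in[of n e, OF eS]
  have scS: "a *\<^sub>R x \<in> S" if "x \<in> S" for a x using that subspace by (rule subspace_scale[rotated])
  have addS: "x + y \<in> S" "x - y \<in> S" if "x \<in> S" "y \<in> S" for x y
    using that subspace by (auto intro: subspace_add subspace_diff)
  show ?case
  proof (cases "\<forall>\<eta>>0. \<exists>u. p (e n - lincomb n u e) < \<eta>")
    case True
    \<comment> \<open>The last vector is approximable by the span of the others, so its coefficient
      is uncontrolled and gets absorbed into the first n. The net is fixed before \<open>c\<close>;
      enlarging \<open>M\<close> by \<open>\<delta>/2\<close> admits the modified combination, while
      the precision of \<open>u\<close> depends on \<open>c n\<close>.\<close>
    obtain F where F: "finite F" "\<And>c. p (lincomb n c e) \<le> M + \<delta>/2 \<Longrightarrow>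
        \<exists>f\<in>F. p (lincomb n c e - lincomb n f e) < \<delta>/2"
      using Suc.IH[of "\<delta>/2" "M + \<delta>/2"] eS Suc.prems(2) by auto
    have "\<exists>f\<in>(\<lambda>f. f(n := 0)) ` F. p (lincomb (Suc n) c e - lincomb (Suc n) f e) < \<delta>"
      if c: "p (lincomb (Suc n) c e) \<le> M" for c
    proof -
      have "0 < \<delta> / (2 * (\<bar>c n\<bar> + 1))" using Suc.prems(2) by (simp add: add_nonneg_pos)
      then obtain u where u: "p (e n - lincomb n u e) < \<delta> / (2 * (\<bar>c n\<bar> + 1))"
        using True by blast
      define x where "x = lincomb (Suc n) c e"
      define x' where "x' = lincomb n (\<lambda>i. c i + c n * u i) e"
      have xS: "x \<in> S" "x' \<in> S"
        unfolding x_def x'_def using Suc.prems(1) by (auto intro!: lincomb_in)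
      have "x - x' = c n *\<^sub>R (e n - lincomb n u e)"
        by (simp add: x_def x'_def lincomb_Suc lincomb_add_scale algebra_simps)
      then have "p (x - x') = \<bar>c n\<bar> * p (e n - lincomb n u e)"
        using scale en L by (simp add: addS)
      also have "\<dots> \<le> \<bar>c n\<bar> * (\<delta> / (2 * (\<bar>c n\<bar> + 1)))"
        using u by (intro mult_left_mono) auto
      also have "\<dots> < \<delta> / 2"
        using Suc.prems(2) by (simp add: field_simps)
      finally have d: "p (x - x') < \<delta> / 2" .
      then have "p x' \<le> M + \<delta>/2"
        using p_diff_le[of x' x] p_diff_commute[of x x'] xS c by (simp add: x_def)
      then obtain f where f: "f \<in> F" "p (x' - lincomb n f e) < \<delta>/2"
        using F(2) unfolding x'_def by blast
      have "p (x - lincomb n f e) < \<delta>"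
        using p_triangle_diff[of x x' "lincomb n f e"] xS L d f(2) by simp
      moreover have "lincomb (Suc n) (f(n := 0)) e = lincomb n f e"
        by (simp add: lincomb_Suc lincomb_upd)
      ultimately show ?thesis using f(1) by (intro bexI[of _ "f(n := 0)"]) (simp_all add: x_def)
    qed
    then show ?thesis using F(1) by blast
  next
    case False
    then obtain \<eta> where \<eta>: "\<eta> > 0" "\<And>u. \<eta> \<le> p (e n - lincomb n u e)"
      by (meson not_le)
    \<comment> \<open>Factoring out \<open>c n\<close> shows that the combination has seminorm at
      least \<open>\<eta>\<close> times the absolute value of \<open>c n\<close>. So
      \<open>K\<close> bounds the last coefficient, and a net of a compact interval handles
      it.\<close>
    define K where "K = M / \<eta>"
    define b where "b = p (e n) + 1"
    have b: "b > 0" "p (e n) \<le> b" using p_nonneg[OF en] by (auto simp: b_def)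
    obtain F where F: "finite F" "\<And>c. p (lincomb n c e) \<le> M + K * p (e n) \<Longrightarrow>
        \<exists>f\<in>F. p (lincomb n c e - lincomb n f e) < \<delta>/2"
      using Suc.IH[of "\<delta>/2" "M + K * p (e n)"] eS Suc.prems(2) by auto
    have "seq_compact {-K..K}" by (simp flip: compact_eq_seq_compact_metric)
    moreover have "\<delta> / (2 * b) > 0" using Suc.prems(2) b(1) by simp
    ultimately obtain G where G: "finite G" "{-K..K} \<subseteq> (\<Union>g\<in>G. ball g (\<delta> / (2 * b)))"
      using seq_compact_imp_totally_bounded[of "{-K..K}"] by blast
    have "\<exists>h\<in>(\<lambda>(f, g). f(n := g)) ` (F \<times> G).
        p (lincomb (Suc n) c e - lincomb (Suc n) h e) < \<delta>"
      if c: "p (lincomb (Suc n) c e) \<le> M" for c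
    proof -
      have cK: "\<bar>c n\<bar> \<le> K"
      proof (cases "c n = 0")
        case True
        have "0 \<le> M" using c p_nonneg[of "lincomb (Suc n) c e"] lincomb_in[of "Suc n" e c] Suc.prems(1)
          by auto
        then show ?thesis using True \<eta>(1) by (simp add: K_def)
      next
        case False
        \<comment> \<open>The summand \<open>0\<close> gives the coefficients the shape required by
          \<open>lincomb_add_scale\<close>.\<close>
        have "lincomb (Suc n) c e = c n *\<^sub>R (e n - lincomb n (\<lambda>i. 0 + (- 1 / c n) * c i) e)"
          using False by (subst lincomb_add_scale) (simp add: lincomb_Suc algebra_simps lincomb_def)
        then have "p (lincomb (Suc n) c e) =
            \<bar>c n\<bar> * p (e n - lincomb n (\<lambda>i. 0 + (- 1 / c n) * c i) e)"
          using scale en L addS by metis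
        also have "\<dots> \<ge> \<bar>c n\<bar> * \<eta>" by (intro mult_left_mono \<eta>) auto
        finally show ?thesis using c \<eta>(1) by (simp add: K_def field_simps)
      qed
      have "p (lincomb n c e) \<le> p (lincomb (Suc n) c e) + p (c n *\<^sub>R e n)"
        using p_diff_le[of "lincomb n c e" "lincomb (Suc n) c e"] L scS[OF en] addS(1)
        by (simp add: lincomb_Suc)
      also have "\<dots> \<le> M + K * p (e n)"
        using c cK scale[OF en] p_nonneg[OF en] by (auto intro!: add_mono mult_right_mono)
      finally obtain f where f: "f \<in> F" "p (lincomb n c e - lincomb n f e) < \<delta>/2"
        using F(2) by blast
      have "c n \<in> {-K..K}" using cK by (simp add: abs_le_iff)
      then obtain g where g: "g \<in> G" "\<bar>c n - g\<bar> < \<delta> / (2 * b)"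
        using G(2) by (auto simp: dist_real_def abs_minus_commute)
      have "lincomb (Suc n) c e - lincomb (Suc n) (f(n := g)) e =
          (lincomb n c e - lincomb n f e) + (c n - g) *\<^sub>R e n"
        by (simp add: lincomb_Suc lincomb_upd algebra_simps)
      then have "p (lincomb (Suc n) c e - lincomb (Suc n) (f(n := g)) e) \<le>
          p (lincomb n c e - lincomb n f e) + \<bar>c n - g\<bar> * p (e n)"
        using triangle[of "lincomb n c e - lincomb n f e" "(c n - g) *\<^sub>R e n"]
          scale[OF en] scS[OF en] addS L by simp
      moreover have "\<bar>c n - g\<bar> * p (e n) \<le> \<delta> / (2 * b) * b"
        using g(2) b p_nonneg[OF en] by (intro mult_mono) auto
      ultimately have "p (lincomb (Suc n) c e - lincomb (Suc n) (f(n := g)) e) < \<delta>"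
        using f(2) b(1) by simp
      then show ?thesis using f(1) g(1) by force
    qed
    moreover have "finite ((\<lambda>(f, g). f(n := g)) ` (F \<times> G))" using F(1) G(1) by simp
    ultimately show ?thesis by blast
  qed
qed

text \<open>The family \<open>e\<close> may be dependent, so subspaces of dimension at most n are
  covered. The value 1 stands for \<open>p y\<close>.\<close>

definition octahedral :: "nat \<Rightarrow> bool" where
  "octahedral n \<longleftrightarrow> (\<forall>\<epsilon>>0. \<forall>e. (\<forall>i<n. e i \<in> S) \<longrightarrow>
     (\<exists>y\<in>S. p y = 1 \<and> (\<forall>c. (1 - \<epsilon>) * (p (lincomb n c e) + 1) \<le> p (lincomb n c e + y))))"

end

section \<open>Octahedrality tested on a dense rational-linear subset\<close>

locale dense_seminormed = seminormed +
  fixes D :: "'a set"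
  assumes D_sub: "D \<subseteq> S"
    and D_dense: "\<And>x \<delta>. x \<in> S \<Longrightarrow> 0 < \<delta> \<Longrightarrow> \<exists>d\<in>D. p (x - d) < \<delta>"
    and D_zero: "0 \<in> D"
    and D_add: "\<And>x y. x \<in> D \<Longrightarrow> y \<in> D \<Longrightarrow> x + y \<in> D"
    and D_scale: "\<And>a x. x \<in> D \<Longrightarrow> of_rat a *\<^sub>R x \<in> D"
begin

lemma lincomb_rat_in_D: "(\<And>i. i < n \<Longrightarrow> q i \<in> D) \<Longrightarrow> lincomb n (\<lambda>i. of_rat (a i)) q \<in> D"
  by (induction n) (auto simp: lincomb_Suc D_add D_scale D_zero lincomb_def[of 0])

text \<open>Approximating each combination on its own would lose the rank bound. One family
  \<open>q\<close> in \<open>D\<close> serves all of \<open>F\<close>, with rational coefficients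
  chosen afterwards, so the approximants remain in the span of n vectors.\<close>

lemma lincomb_approx:
  assumes e: "\<And>i. i < n \<Longrightarrow> e i \<in> S" and "finite F" and \<delta>: "0 < \<delta>"
  shows "\<exists>q a. (\<forall>i<n. q i \<in> D) \<and>
    (\<forall>f\<in>F. p (lincomb n f e - lincomb n (\<lambda>i. of_rat (a f i)) q) < \<delta>)"
proof -
  define K where "K = (\<Sum>f\<in>F. \<Sum>i<n. \<bar>f i\<bar>) + 1"
  have K: "\<bar>f i\<bar> \<le> K" if "f \<in> F" "i < n" for f i
  proof -
    have "\<bar>f i\<bar> \<le> (\<Sum>i<n. \<bar>f i\<bar>)" using that by (intro member_le_sum) auto
    also have "\<dots> \<le> (\<Sum>f\<in>F. \<Sum>i<n. \<bar>f i\<bar>)"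
      using that assms by (intro member_le_sum[of f F "\<lambda>f. \<Sum>i<n. \<bar>f i\<bar>"]) (auto intro: sum_nonneg)
    finally show ?thesis by (simp add: K_def)
  qed
  have Kpos: "K > 0" unfolding K_def by (intro add_nonneg_pos sum_nonneg) auto
  \<comment> \<open>Each of the n summands costs at most \<open>2 * \<tau>\<close>: one
    \<open>\<tau>\<close> for the vector, one for the coefficient. \<open>Suc n\<close> makes the
    total strictly smaller than \<open>\<delta>\<close> and covers n = 0.\<close>
  define \<tau> where "\<tau> = \<delta> / (2 * real (Suc n))"
  have \<tau>: "\<tau> > 0" using \<delta> by (simp add: \<tau>_def)
  have "\<forall>i. i < n \<longrightarrow> (\<exists>d. d \<in> D \<and> p (e i - d) < \<tau> / K)"
    using D_dense[OF e, of _ "\<tau> / K"] \<tau> Kpos by (auto simp: Bex_def)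
  then have "\<exists>q. \<forall>i. i < n \<longrightarrow> q i \<in> D \<and> p (e i - q i) < \<tau> / K"
    by metis
  then obtain q where q: "\<And>i. i < n \<Longrightarrow> q i \<in> D" "\<And>i. i < n \<Longrightarrow> p (e i - q i) < \<tau> / K"
    by blast
  have qS: "q i \<in> S" if "i < n" for i using q(1) D_sub that by auto
  have "\<exists>r::rat. \<bar>f i - of_rat r\<bar> * p (q i) \<le> \<tau>" if "i < n" for f :: "nat \<Rightarrow> real" and i
  proof -
    have pos: "0 < \<tau> / (p (q i) + 1)" using \<tau> p_nonneg[OF qS[OF that]] by (simp add: add_nonneg_pos)
    then obtain r :: rat where "f i < of_rat r" "of_rat r < f i + \<tau> / (p (q i) + 1)"
      using of_rat_dense[of "f i" "f i + \<tau> / (p (q i) + 1)"] by auto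
    then have "\<bar>f i - of_rat r\<bar> * p (q i) \<le> \<tau> / (p (q i) + 1) * (p (q i) + 1)"
      using p_nonneg[OF qS[OF that]] by (intro mult_mono) auto
    also have "\<dots> = \<tau>" using p_nonneg[OF qS[OF that]] by simp
    finally show ?thesis by blast
  qed
  then have "\<forall>f. \<forall>i. \<exists>r::rat. i < n \<longrightarrow> \<bar>f i - of_rat r\<bar> * p (q i) \<le> \<tau>" by blast
  then obtain a :: "(nat \<Rightarrow> real) \<Rightarrow> nat \<Rightarrow> rat"
    where a: "\<And>f i. i < n \<Longrightarrow> \<bar>f i - of_rat (a f i)\<bar> * p (q i) \<le> \<tau>"
    unfolding choice_iff by blast
  have "p (lincomb n f e - lincomb n (\<lambda>i. of_rat (a f i)) q) < \<delta>" if f: "f \<in> F" for f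
  proof -
    have "lincomb n f e - lincomb n (\<lambda>i. of_rat (a f i)) q =
        (\<Sum>i<n. f i *\<^sub>R (e i - q i) + (f i - of_rat (a f i)) *\<^sub>R q i)"
      by (simp add: lincomb_def algebra_simps flip: sum_subtractf)
    also have "p \<dots> \<le> (\<Sum>i<n. p (f i *\<^sub>R (e i - q i) + (f i - of_rat (a f i)) *\<^sub>R q i))"
      using subspace e qS
      by (intro p_sum_le) (auto intro!: subspace_add subspace_scale subspace_diff)
    also have "\<dots> \<le> (\<Sum>i<n. 2 * \<tau>)"
    proof (rule sum_mono)
      fix i assume "i \<in> {..<n}"
      then have i: "i < n" by simp
      have eq: "e i - q i \<in> S" using subspace e qS i by (auto intro: subspace_diff)
      have "p (f i *\<^sub>R (e i - q i) + (f i - of_rat (a f i)) *\<^sub>R q i) \<le>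
          \<bar>f i\<bar> * p (e i - q i) + \<bar>f i - of_rat (a f i)\<bar> * p (q i)"
        using triangle[of "f i *\<^sub>R (e i - q i)" "(f i - of_rat (a f i)) *\<^sub>R q i"]
          scale[OF eq] scale[OF qS[OF i]] subspace eq qS[OF i] by (simp add: subspace_scale)
      also have "\<bar>f i\<bar> * p (e i - q i) \<le> K * (\<tau> / K)"
        using K[OF f i] q(2)[OF i] p_nonneg[OF eq] Kpos by (intro mult_mono) auto
      also have "K * (\<tau> / K) = \<tau>" using Kpos by simp
      finally show "p (f i *\<^sub>R (e i - q i) + (f i - of_rat (a f i)) *\<^sub>R q i) \<le> 2 * \<tau>"
        using a[OF i, of f] by simp
    qed
    also have "\<dots> < \<delta>" using \<delta> by (simp add: \<tau>_def field_simps)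
    finally show ?thesis .
  qed
  then show ?thesis using q(1) by blast
qed

text \<open>On a finite set the seminorm is bounded, so a factor close to 1 can be traded for an
  additive error. The strict inequalities are the form that later gives open conditions on the
  seminorm. The clause about \<open>q\<close> lets \<open>octahedral n\<close> be applied to all of
  \<open>F\<close> at once.\<close>

lemma octahedral_iff_dense:
  "octahedral n \<longleftrightarrow> (\<forall>F (k::nat). finite F \<and> F \<subseteq> D \<and>
      (\<exists>q. (\<forall>i<n. q i \<in> D) \<and> (\<forall>x\<in>F. \<exists>c. x = lincomb n c q)) \<longrightarrow>
      (\<exists>r\<in>D. \<bar>p r - 1\<bar> < 1 / Suc k \<and> (\<forall>x\<in>F. p x + 1 - 1 / Suc k < p (x + r))))"
  (is "_ \<longleftrightarrow> ?R")
proof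
  assume oct: "octahedral n"
  show ?R
  proof (intro allI impI, elim conjE exE)
    fix F k q
    assume F: "finite F" "F \<subseteq> D" and q: "\<forall>i<n. q i \<in> D" and Fq: "\<forall>x\<in>F. \<exists>c. x = lincomb n c q"
    \<comment> \<open>With this bound on \<open>p x + 1\<close> over \<open>F\<close>, octahedrality
      for \<open>\<tau> / K\<close> loses at most \<open>\<tau>\<close> additively.\<close>
    define K where "K = (\<Sum>x\<in>F. p x) + 1"
    have K: "p x + 1 \<le> K" if "x \<in> F" for x
      unfolding K_def using that F D_sub p_nonneg by (intro add_right_mono member_le_sum) auto
    have Kpos: "K > 0"
      unfolding K_def using F D_sub p_nonneg by (intro add_nonneg_pos sum_nonneg) auto
    \<comment> \<open>One \<open>\<tau>\<close> is lost to octahedrality, one to replacing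
      \<open>y\<close> by \<open>r\<close>, and one is slack.\<close>
    define \<tau> where "\<tau> = 1 / (3 * real (Suc k))"
    have \<tau>: "\<tau> > 0" by (simp add: \<tau>_def)
    obtain y where y: "y \<in> S" "p y = 1"
      "\<And>c. (1 - \<tau> / K) * (p (lincomb n c q) + 1) \<le> p (lincomb n c q + y)"
      using oct[unfolded octahedral_def, rule_format, of "\<tau> / K" q] q D_sub \<tau> Kpos by auto
    obtain r where r: "r \<in> D" "p (y - r) < \<tau>" using D_dense[OF y(1) \<tau>] by blast
    have rS: "r \<in> S" using r D_sub by auto
    have three: "3 * \<tau> = 1 / Suc k" by (simp add: \<tau>_def field_simps)
    have "\<bar>p r - 1\<bar> < 1 / Suc k"
      using p_abs_diff_le[OF y(1) rS] r(2) y(2) \<tau> three by linarith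
    moreover have "p x + 1 - 1 / Suc k < p (x + r)" if x: "x \<in> F" for x
    proof -
      obtain c where c: "x = lincomb n c q" using Fq x by blast
      have xS: "x \<in> S" using x F D_sub by auto
      have "\<tau> / K * (p x + 1) \<le> \<tau> / K * K" using K[OF x] \<tau> Kpos by (intro mult_left_mono) auto
      also have "\<dots> = \<tau>" using Kpos by simp
      finally have "p x + 1 - \<tau> \<le> p (x + y)" using y(3)[of c] by (simp add: c algebra_simps)
      moreover have "p (x + y) - p (x + r) \<le> p (y - r)"
        using p_diff_le[of "x + y" "x + r"] xS y(1) rS subspace by (simp add: subspace_add)
      ultimately show ?thesis using r(2) \<tau> three by linarith
    qed
    ultimately show "\<exists>r\<in>D. \<bar>p r - 1\<bar> < 1 / Suc k \<and> (\<forall>x\<in>F. p x + 1 - 1 / Suc k < p (x + r))"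
      using r(1) by blast
  qed
next
  assume R: ?R
  show "octahedral n"
    unfolding octahedral_def
  proof (intro allI impI)
    fix \<epsilon> :: real and e
    assume \<epsilon>: "\<epsilon> > 0" and e: "\<forall>i<n. e i \<in> S"
    \<comment> \<open>Six errors of size \<open>\<delta>\<close> add up below: two from rounding
      \<open>x\<close> to \<open>d f\<close>, one from the test, three from passing from
      \<open>d f + r\<close> to \<open>x + y\<close>. The bound 1/2 keeps \<open>p r\<close>
      positive for the normalisation.\<close>
    obtain k :: nat where k: "1 / Suc k < min (\<epsilon> / 6) (1/2)"
      using reals_Archimedean[of "min (\<epsilon> / 6) (1/2)"] \<epsilon> by (auto simp: inverse_eq_divide)
    define \<delta> where "\<delta> = 1 / real (Suc k)"
    have \<delta>: "\<delta> > 0" "6 * \<delta> < \<epsilon>" "\<delta> < 1/2" using k by (auto simp: \<delta>_def)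
    note L = lincomb_in[of n e, OF e[rule_format]]
    \<comment> \<open>Beyond radius \<open>2 / \<epsilon>\<close> the slack
      \<open>\<epsilon> * p x\<close> is at least 2, which pays for the loss in the reverse triangle
      inequality.\<close>
    obtain F where F: "finite F" "\<And>c. p (lincomb n c e) \<le> 2 / \<epsilon> \<Longrightarrow>
        \<exists>f\<in>F. p (lincomb n c e - lincomb n f e) < \<delta>"
      using lincomb_ball_totally_bounded[of n e \<delta> "2 / \<epsilon>"] e \<delta>(1) by blast
    obtain q a where q: "\<forall>i<n. q i \<in> D"
      and a: "\<forall>f\<in>F. p (lincomb n f e - lincomb n (\<lambda>i. of_rat (a f i)) q) < \<delta>"
      using lincomb_approx[of n e F \<delta>] e F(1) \<delta>(1) by blast
    define d where "d f = lincomb n (\<lambda>i. of_rat (a f i)) q" for f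
    have dD: "d f \<in> D" for f unfolding d_def using q by (intro lincomb_rat_in_D) auto
    have dS: "d f \<in> S" for f using dD D_sub by auto
    obtain r where r: "r \<in> D" "\<bar>p r - 1\<bar> < \<delta>" "\<And>f. f \<in> F \<Longrightarrow> p (d f) + 1 - \<delta> < p (d f + r)"
      using R[rule_format, of "d ` F" k] F(1) dD q unfolding \<delta>_def d_def by blast
    have rS: "r \<in> S" using r D_sub by auto
    have pr: "p r > 0" using r(2) \<delta>(3) by linarith
    \<comment> \<open>Rescaling moves \<open>r\<close> by exactly the deviation of
      \<open>p r\<close> from 1, hence by less than \<open>\<delta>\<close>.\<close>
    define y where "y = (1 / p r) *\<^sub>R r"
    have yS: "y \<in> S" unfolding y_def using rS subspace by (simp add: subspace_scale)
    have py: "p y = 1" unfolding y_def using pr by (simp add: scale rS)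
    have "r - y = (1 - 1 / p r) *\<^sub>R r" by (simp add: y_def algebra_simps)
    then have "p (r - y) = \<bar>1 - 1 / p r\<bar> * p r" by (simp add: scale rS)
    also have "\<dots> = \<bar>(1 - 1 / p r) * p r\<bar>" using pr by (simp add: abs_mult)
    also have "\<dots> = \<bar>p r - 1\<bar>" using pr by (simp add: algebra_simps)
    finally have ry: "p (r - y) < \<delta>" using r(2) by simp
    have "(1 - \<epsilon>) * (p (lincomb n c e) + 1) \<le> p (lincomb n c e + y)" for c
    proof (cases "p (lincomb n c e) \<le> 2 / \<epsilon>")
      case True
      then obtain f where f: "f \<in> F" "p (lincomb n c e - lincomb n f e) < \<delta>" using F(2) by blast
      define x where "x = lincomb n c e"
      have xS: "x \<in> S" using L by (simp add: x_def)
      have xd: "p (x - d f) < 2 * \<delta>"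
        using p_triangle_diff[of x "lincomb n f e" "d f"] xS L dS f a by (force simp: x_def d_def)
      have "p (d f + r) - p (x + y) \<le> p ((d f + r) - (x + y))"
        using subspace dS rS xS yS by (intro p_diff_le) (auto intro: subspace_add)
      also have "(d f + r) - (x + y) = (d f - x) + (r - y)" by simp
      also have "p \<dots> \<le> p (d f - x) + p (r - y)"
        using subspace dS rS xS yS by (intro triangle) (auto intro: subspace_diff)
      finally have "p (d f + r) - p (x + y) < 3 * \<delta>"
        using xd ry p_diff_commute[OF xS dS[of f]] by linarith
      moreover have "p x - p (d f) < 2 * \<delta>" using p_diff_le[OF xS dS[of f]] xd by linarith
      ultimately have "p x + 1 - 6 * \<delta> \<le> p (x + y)" using r(3)[OF f(1)] by linarith
      moreover have "6 * \<delta> \<le> \<epsilon> * (p x + 1)"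
        using \<delta>(2) mult_left_mono[of 1 "p x + 1" \<epsilon>] \<epsilon> p_nonneg[OF xS] by linarith
      ultimately show ?thesis by (simp add: x_def algebra_simps)
    next
      case False
      then have "2 \<le> \<epsilon> * (p (lincomb n c e))" using \<epsilon> by (simp add: field_simps)
      moreover have "p (lincomb n c e) - 1 \<le> p (lincomb n c e + y)"
        using p_diff_le[of "lincomb n c e" "- y"] L yS py subspace by (simp add: subspace_neg)
      ultimately show ?thesis using \<epsilon> by (simp add: algebra_simps)
    qed
    then show "\<exists>y\<in>S. p y = 1 \<and> (\<forall>c. (1 - \<epsilon>) * (p (lincomb n c e) + 1) \<le> p (lincomb n c e + y))"
      using yS py by blast
  qed
qed

end

section \<open>The extension of a rational seminorm\<close>

lemma Vset_add: "q \<in> Vset \<Longrightarrow> r \<in> Vset \<Longrightarrow> (\<lambda>i. q i + r i) \<in> Vset"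
  unfolding Vset_def
  by (auto intro: finite_subset[of _ "{i. q i \<noteq> 0} \<union> {i. r i \<noteq> 0}"])

lemma Vset_scale: "q \<in> Vset \<Longrightarrow> (\<lambda>i. a * q i) \<in> Vset"
  unfolding Vset_def by (auto intro: finite_subset[of _ "{i. q i \<noteq> 0}"])

lemma Vset_diff: "q \<in> Vset \<Longrightarrow> r \<in> Vset \<Longrightarrow> (\<lambda>i. q i - r i) \<in> Vset"
  using Vset_add[OF _ Vset_scale[of r "-1"], of q] by simp

lemma Vset_finite_support: "finite T \<Longrightarrow> (\<And>i. i \<notin> T \<Longrightarrow> q i = 0) \<Longrightarrow> q \<in> Vset"
  unfolding Vset_def by (auto intro: finite_subset[of _ T])

lemma subspace_c00: "subspace c00"
proof (rule subspaceI)
  fix x y :: "nat \<Rightarrow> real" and a :: real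
  assume x: "x \<in> c00"
  then show "a *\<^sub>R x \<in> c00"
    unfolding c00_def by (auto intro: finite_subset[of _ "{i. x i \<noteq> 0}"])
  assume "y \<in> c00"
  with x show "x + y \<in> c00"
    unfolding c00_def by (auto intro: finite_subset[of _ "{i. x i \<noteq> 0} \<union> {i. y i \<noteq> 0}"])
qed (simp add: c00_def)

definition ratvec :: "(nat \<Rightarrow> rat) \<Rightarrow> nat \<Rightarrow> real" where
  "ratvec q = (\<lambda>i. of_rat (q i))"

lemma ratvec_apply [simp]: "ratvec q i = of_rat (q i)"
  by (simp add: ratvec_def)

lemma ratvec_c00: "q \<in> Vset \<Longrightarrow> ratvec q \<in> c00"
  by (simp add: Vset_def c00_def)

lemma ratvec_add: "ratvec (\<lambda>i. q i + r i) = ratvec q + ratvec r"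
  by (auto simp: fun_eq_iff of_rat_add)

lemma ratvec_scale: "ratvec (\<lambda>i. a * q i) = of_rat a *\<^sub>R ratvec q"
  by (auto simp: fun_eq_iff of_rat_mult)

lemma real_approx_rat:
  fixes x :: real
  assumes "0 < d"
  shows "\<exists>q::rat. (x = 0 \<longrightarrow> q = 0) \<and> \<bar>x - of_rat q\<bar> < d"
proof (cases "x = 0")
  case True
  then show ?thesis using assms by (intro exI[of _ 0]) auto
next
  case False
  obtain q :: rat where "x < of_rat q" "of_rat q < x + d"
    using of_rat_dense[of x "x + d"] assms by auto
  then show ?thesis using False by (intro exI[of _ q]) auto
qed

text \<open>Approximants vanish wherever \<open>x\<close> does, because \<open>mu_bar\<close> only
  admits rational vectors supported in the support of \<open>x\<close>.\<close>

lemma c00_approx_rat: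
  assumes "x \<in> c00"
  shows "\<exists>a. (\<forall>k. a k \<in> Vset) \<and> (\<forall>k i. x i = 0 \<longrightarrow> a k i = 0) \<and>
    (\<forall>i. (\<lambda>k. of_rat (a k i)) \<longlonglongrightarrow> x i)"
proof -
  have "\<forall>k i. \<exists>q::rat. (x i = 0 \<longrightarrow> q = 0) \<and> \<bar>x i - of_rat q\<bar> < inverse (Suc k)"
    using real_approx_rat by simp
  then obtain a :: "nat \<Rightarrow> nat \<Rightarrow> rat"
    where a: "\<And>k i. x i = 0 \<Longrightarrow> a k i = 0" "\<And>k i. \<bar>x i - of_rat (a k i)\<bar> < inverse (Suc k)"
    unfolding choice_iff by blast
  have "(\<lambda>k. of_rat (a k i)) \<longlonglongrightarrow> x i" for i
  proof (rule Lim_null[THEN iffD2], rule Lim_null_comparison)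
    show "\<forall>\<^sub>F k in sequentially. norm (of_rat (a k i) - x i) \<le> inverse (Suc k)"
      using a(2) by (auto simp: abs_minus_commute intro!: always_eventually less_imp_le)
  qed (rule LIMSEQ_inverse_real_of_nat)
  moreover have "a k \<in> Vset" for k
    using assms a(1) by (intro Vset_finite_support[of "{i. x i \<noteq> 0}"]) (auto simp: c00_def)
  ultimately show ?thesis using a(1) by blast
qed

definition unit_V :: "nat \<Rightarrow> nat \<Rightarrow> rat" where
  "unit_V i = (\<lambda>j. if j = i then 1 else 0)"

lemma unit_V_Vset: "unit_V i \<in> Vset"
  by (rule Vset_finite_support[of "{i}"]) (auto simp: unit_V_def)

lemma seminorm_V_add:
  "seminorm_V \<mu> \<Longrightarrow> q \<in> Vset \<Longrightarrow> r \<in> Vset \<Longrightarrow> \<mu> (\<lambda>i. q i + r i) \<le> \<mu> q + \<mu> r"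
  by (simp add: seminorm_V_def)

lemma seminorm_V_scale:
  "seminorm_V \<mu> \<Longrightarrow> q \<in> Vset \<Longrightarrow> \<mu> (\<lambda>i. a * q i) = \<bar>of_rat a\<bar> * \<mu> q"
  by (simp add: seminorm_V_def)

text \<open>Coordinates are peeled off one at a time. This weighted l_1 bound makes
  \<open>\<mu>\<close> Lipschitz on each fixed finite support, which is the source of its extension
  to \<open>c00\<close>.\<close>

lemma seminorm_V_le_sum:
  assumes mu: "seminorm_V \<mu>" and "finite T" and "\<And>i. i \<notin> T \<Longrightarrow> q i = 0"
  shows "\<mu> q \<le> (\<Sum>i\<in>T. \<bar>of_rat (q i)\<bar> * \<mu> (unit_V i))"
  using assms(2,3)
proof (induction T arbitrary: q rule: finite_induct)
  case empty
  have "\<mu> (\<lambda>i. 0 * unit_V 0 i) = \<bar>of_rat 0\<bar> * \<mu> (unit_V 0)"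
    by (rule seminorm_V_scale[OF mu unit_V_Vset])
  moreover have "q = (\<lambda>i. 0)" using empty by auto
  ultimately show ?case by simp
next
  case (insert x T)
  have V: "q(x := 0) \<in> Vset"
    using insert by (intro Vset_finite_support[of T]) auto
  have "q = (\<lambda>i. (q(x := 0)) i + q x * unit_V x i)" by (auto simp: unit_V_def)
  then have "\<mu> q = \<mu> (\<lambda>i. (q(x := 0)) i + q x * unit_V x i)" by simp
  also have "\<dots> \<le> \<mu> (q(x := 0)) + \<mu> (\<lambda>i. q x * unit_V x i)"
    by (rule seminorm_V_add[OF mu V Vset_scale[OF unit_V_Vset]])
  also have "\<mu> (\<lambda>i. q x * unit_V x i) = \<bar>of_rat (q x)\<bar> * \<mu> (unit_V x)"
    by (rule seminorm_V_scale[OF mu unit_V_Vset])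
  also have "\<mu> (q(x := 0)) \<le> (\<Sum>i\<in>T. \<bar>of_rat ((q(x := 0)) i)\<bar> * \<mu> (unit_V i))"
    using insert.prems by (intro insert.IH) auto
  also have "\<dots> = (\<Sum>i\<in>T. \<bar>of_rat (q i)\<bar> * \<mu> (unit_V i))"
    using insert.hyps by (intro sum.cong) auto
  finally show ?case using insert.hyps by simp
qed

lemma seminorm_V_nonneg:
  assumes mu: "seminorm_V \<mu>" and q: "q \<in> Vset"
  shows "0 \<le> \<mu> q"
proof -
  have "\<mu> (\<lambda>i. 0 * q i) = \<bar>of_rat 0\<bar> * \<mu> q" "\<mu> (\<lambda>i. (-1) * q i) = \<bar>of_rat (-1)\<bar> * \<mu> q"
    by (rule seminorm_V_scale[OF mu q])+
  moreover have "\<mu> (\<lambda>i. q i + (-1) * q i) \<le> \<mu> q + \<mu> (\<lambda>i. (-1) * q i)"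
    by (rule seminorm_V_add[OF mu q Vset_scale[OF q]])
  ultimately show ?thesis by simp
qed

lemma seminorm_V_diff_le:
  assumes mu: "seminorm_V \<mu>" and q: "q \<in> Vset" and r: "r \<in> Vset"
  shows "\<bar>\<mu> q - \<mu> r\<bar> \<le> \<mu> (\<lambda>i. q i - r i)"
proof -
  have "\<mu> (\<lambda>i. (q i - r i) + r i) \<le> \<mu> (\<lambda>i. q i - r i) + \<mu> r"
    "\<mu> (\<lambda>i. (r i - q i) + q i) \<le> \<mu> (\<lambda>i. r i - q i) + \<mu> q"
    by (rule seminorm_V_add[OF mu Vset_diff[OF q r] r] seminorm_V_add[OF mu Vset_diff[OF r q] q])+
  moreover have "\<mu> (\<lambda>i. (-1) * (q i - r i)) = \<bar>of_rat (-1)\<bar> * \<mu> (\<lambda>i. q i - r i)"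
    by (rule seminorm_V_scale[OF mu Vset_diff[OF q r]])
  ultimately show ?thesis by simp
qed

lemma seminorm_V_lipschitz:
  assumes mu: "seminorm_V \<mu>" and T: "finite T"
    and q: "\<And>i. i \<notin> T \<Longrightarrow> q i = 0" and r: "\<And>i. i \<notin> T \<Longrightarrow> r i = 0"
  shows "\<bar>\<mu> q - \<mu> r\<bar> \<le> (\<Sum>i\<in>T. \<bar>of_rat (q i) - of_rat (r i)\<bar> * \<mu> (unit_V i))"
  using seminorm_V_diff_le[OF mu, of q r] seminorm_V_le_sum[OF mu T, of "\<lambda>i. q i - r i"]
    Vset_finite_support[OF T] q r
  by (force simp: of_rat_diff)

text \<open>This turns the definite description in \<open>mu_bar\<close> into a limit. The set
  \<open>T\<close> may exceed the support of \<open>x\<close>, as happens for sums in which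
  coordinates cancel.\<close>

lemma mu_bar_tendsto:
  assumes mu: "seminorm_V \<mu>" and x: "x \<in> c00" and T: "finite T"
    and q: "\<And>k i. i \<notin> T \<Longrightarrow> q k i = 0" and lim: "\<And>i. (\<lambda>k. of_rat (q k i)) \<longlonglongrightarrow> x i"
  shows "(\<lambda>k. \<mu> (q k)) \<longlonglongrightarrow> mu_bar \<mu> x"
proof -
  define T0 where "T0 = {i. x i \<noteq> 0}"
  have T0: "finite T0" using x by (simp add: c00_def T0_def)
  obtain a where a: "\<And>k. a k \<in> Vset" "\<And>k i. x i = 0 \<Longrightarrow> a k i = 0"
    "\<And>i. (\<lambda>k. of_rat (a k i)) \<longlonglongrightarrow> x i"
    using c00_approx_rat[OF x] by blast
  have a0: "i \<notin> T0 \<Longrightarrow> a k i = 0" for k i using a(2) by (simp add: T0_def)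
  have u: "0 \<le> \<mu> (unit_V i)" for i by (rule seminorm_V_nonneg[OF mu unit_V_Vset])
  \<comment> \<open>A common bound on the weights reduces the weighted estimate to the plain sum in
    \<open>mu_bar\<close>, with \<open>\<epsilon> / L\<close> as the required
    \<open>\<delta>\<close>.\<close>
  define L where "L = (\<Sum>i\<in>T0. \<mu> (unit_V i)) + 1"
  have L: "\<mu> (unit_V i) \<le> L" if "i \<in> T0" for i
    using member_le_sum[OF that, of "\<lambda>i. \<mu> (unit_V i)"] T0 u by (simp add: L_def)
  have Lpos: "L > 0" unfolding L_def using u by (intro add_nonneg_pos sum_nonneg) auto
  have "Cauchy (\<lambda>k. \<mu> (a k))"
  proof (rule metric_CauchyI)
    fix e :: real assume e: "e > 0"
    have "(\<lambda>k. \<Sum>i\<in>T0. \<bar>of_rat (a k i) - x i\<bar> * \<mu> (unit_V i)) \<longlonglongrightarrow> (\<Sum>i\<in>T0. \<bar>x i - x i\<bar> * \<mu> (unit_V i))"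
      by (intro tendsto_intros a)
    then have "\<forall>\<^sub>F k in sequentially. (\<Sum>i\<in>T0. \<bar>of_rat (a k i) - x i\<bar> * \<mu> (unit_V i)) < e/2"
      using e by (intro order_tendstoD(2)) auto
    then obtain K where K: "\<And>k. k \<ge> K \<Longrightarrow> (\<Sum>i\<in>T0. \<bar>of_rat (a k i) - x i\<bar> * \<mu> (unit_V i)) < e/2"
      unfolding eventually_sequentially by blast
    have "dist (\<mu> (a m)) (\<mu> (a n)) < e" if mn: "m \<ge> K" "n \<ge> K" for m n
    proof -
      have "\<bar>\<mu> (a m) - \<mu> (a n)\<bar> \<le> (\<Sum>i\<in>T0. \<bar>of_rat (a m i) - of_rat (a n i)\<bar> * \<mu> (unit_V i))"
        using a0 by (intro seminorm_V_lipschitz[OF mu T0]) auto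
      also have "\<dots> \<le> (\<Sum>i\<in>T0. \<bar>of_rat (a m i) - x i\<bar> * \<mu> (unit_V i) + \<bar>of_rat (a n i) - x i\<bar> * \<mu> (unit_V i))"
        unfolding distrib_right[symmetric] using u by (intro sum_mono mult_right_mono) auto
      also have "\<dots> < e" using K[OF mn(1)] K[OF mn(2)] by (simp add: sum.distrib)
      finally show ?thesis by (simp add: dist_real_def)
    qed
    then show "\<exists>M. \<forall>m\<ge>M. \<forall>n\<ge>M. dist (\<mu> (a m)) (\<mu> (a n)) < e" by blast
  qed
  then obtain r where r: "(\<lambda>k. \<mu> (a k)) \<longlonglongrightarrow> r" by (auto simp: Cauchy_convergent_iff convergent_def)
  define P where "P r \<longleftrightarrow> (\<forall>\<epsilon>>0. \<exists>\<delta>>0. \<forall>q\<in>Vset. {i. q i \<noteq> 0} \<subseteq> T0 \<and>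
      (\<Sum>i\<in>T0. \<bar>x i - of_rat (q i)\<bar>) < \<delta> \<longrightarrow> \<bar>\<mu> q - r\<bar> < \<epsilon>)" for r
  have "P r"
    unfolding P_def
  proof (intro allI impI)
    fix \<epsilon> :: real assume \<epsilon>: "\<epsilon> > 0"
    have "\<bar>\<mu> s - r\<bar> < \<epsilon>" if s: "{i. s i \<noteq> 0} \<subseteq> T0" "(\<Sum>i\<in>T0. \<bar>x i - of_rat (s i)\<bar>) < \<epsilon> / L" for s
    proof -
      have s0: "i \<notin> T0 \<Longrightarrow> s i = 0" for i using s(1) by auto
      have "\<bar>\<mu> s - r\<bar> \<le> (\<Sum>i\<in>T0. \<bar>of_rat (s i) - x i\<bar> * \<mu> (unit_V i))"
      proof (rule tendsto_le[OF sequentially_bot])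
        show "(\<lambda>k. \<Sum>i\<in>T0. \<bar>of_rat (s i) - of_rat (a k i)\<bar> * \<mu> (unit_V i)) \<longlonglongrightarrow>
            (\<Sum>i\<in>T0. \<bar>of_rat (s i) - x i\<bar> * \<mu> (unit_V i))" by (intro tendsto_intros a)
        show "(\<lambda>k. \<bar>\<mu> s - \<mu> (a k)\<bar>) \<longlonglongrightarrow> \<bar>\<mu> s - r\<bar>" by (intro tendsto_intros r)
        show "\<forall>\<^sub>F k in sequentially. \<bar>\<mu> s - \<mu> (a k)\<bar> \<le> (\<Sum>i\<in>T0. \<bar>of_rat (s i) - of_rat (a k i)\<bar> * \<mu> (unit_V i))"
          using a0 s0 by (intro always_eventually allI seminorm_V_lipschitz[OF mu T0]) auto
      qed
      also have "\<dots> \<le> (\<Sum>i\<in>T0. \<bar>x i - of_rat (s i)\<bar> * L)"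
        using L by (intro sum_mono) (auto simp: abs_minus_commute intro: mult_left_mono)
      also have "\<dots> = (\<Sum>i\<in>T0. \<bar>x i - of_rat (s i)\<bar>) * L" by (simp add: sum_distrib_right)
      also have "\<dots> < \<epsilon>" using s(2) Lpos by (simp add: field_simps)
      finally show ?thesis .
    qed
    then show "\<exists>\<delta>>0. \<forall>q\<in>Vset. {i. q i \<noteq> 0} \<subseteq> T0 \<and>
      (\<Sum>i\<in>T0. \<bar>x i - of_rat (q i)\<bar>) < \<delta> \<longrightarrow> \<bar>\<mu> q - r\<bar> < \<epsilon>"
      using \<epsilon> Lpos by (intro exI[of _ "\<epsilon> / L"]) auto
  qed
  \<comment> \<open>Every number satisfying \<open>P\<close> is the limit of the same sequence,
    which is the uniqueness that \<open>THE\<close> demands.\<close>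
  have Plim: "(\<lambda>k. \<mu> (a k)) \<longlonglongrightarrow> r'" if Pr': "P r'" for r'
  proof (rule LIMSEQ_I)
    fix e :: real assume "e > 0"
    then obtain d where d: "d > 0" "\<forall>s\<in>Vset. {i. s i \<noteq> 0} \<subseteq> T0 \<and>
      (\<Sum>i\<in>T0. \<bar>x i - of_rat (s i)\<bar>) < d \<longrightarrow> \<bar>\<mu> s - r'\<bar> < e"
      using Pr'[unfolded P_def, rule_format, of e] by auto
    have "(\<lambda>k. \<Sum>i\<in>T0. \<bar>x i - of_rat (a k i)\<bar>) \<longlonglongrightarrow> (\<Sum>i\<in>T0. \<bar>x i - x i\<bar>)"
      by (intro tendsto_intros a)
    then have "\<forall>\<^sub>F k in sequentially. (\<Sum>i\<in>T0. \<bar>x i - of_rat (a k i)\<bar>) < d"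
      using d(1) by (intro order_tendstoD(2)) auto
    then obtain K where "\<And>k. k \<ge> K \<Longrightarrow> (\<Sum>i\<in>T0. \<bar>x i - of_rat (a k i)\<bar>) < d"
      unfolding eventually_sequentially by blast
    moreover have "{i. a k i \<noteq> 0} \<subseteq> T0" for k using a0 by auto
    ultimately show "\<exists>K. \<forall>k\<ge>K. norm (\<mu> (a k) - r') < e"
      using d(2) a(1) by (intro exI[of _ K]) auto
  qed
  have "mu_bar \<mu> x = (THE r. P r)" unfolding mu_bar_def P_def T0_def ..
  also have "\<dots> = r" using \<open>P r\<close> Plim r LIMSEQ_unique by blast
  finally have rbar: "mu_bar \<mu> x = r" .
  \<comment> \<open>The given sequence is compared with the one supported in \<open>T0\<close>; both
    live on \<open>T \<union> T0\<close>, where the Lipschitz bound applies.\<close>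
  have "(\<lambda>k. \<mu> (q k) - \<mu> (a k)) \<longlonglongrightarrow> 0"
  proof (rule Lim_null_comparison)
    have "\<bar>\<mu> (q k) - \<mu> (a k)\<bar> \<le> (\<Sum>i\<in>T\<union>T0. \<bar>of_rat (q k i) - of_rat (a k i)\<bar> * \<mu> (unit_V i))" for k
      using T T0 q a0 by (intro seminorm_V_lipschitz[OF mu]) auto
    then show "\<forall>\<^sub>F k in sequentially. norm (\<mu> (q k) - \<mu> (a k)) \<le>
      (\<Sum>i\<in>T\<union>T0. \<bar>of_rat (q k i) - of_rat (a k i)\<bar> * \<mu> (unit_V i))" by simp
    have "(\<lambda>k. \<Sum>i\<in>T\<union>T0. \<bar>of_rat (q k i) - of_rat (a k i)\<bar> * \<mu> (unit_V i)) \<longlonglongrightarrow>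
      (\<Sum>i\<in>T\<union>T0. \<bar>x i - x i\<bar> * \<mu> (unit_V i))" by (intro tendsto_intros a lim)
    then show "(\<lambda>k. \<Sum>i\<in>T\<union>T0. \<bar>of_rat (q k i) - of_rat (a k i)\<bar> * \<mu> (unit_V i)) \<longlonglongrightarrow> 0" by simp
  qed
  from tendsto_add[OF this r] show ?thesis by (simp add: rbar)
qed

lemma mu_bar_ratvec:
  assumes "seminorm_V \<mu>" and "q \<in> Vset"
  shows "mu_bar \<mu> (ratvec q) = \<mu> q"
proof -
  have "(\<lambda>k::nat. \<mu> q) \<longlonglongrightarrow> mu_bar \<mu> (ratvec q)"
    using assms by (intro mu_bar_tendsto[where T = "{i. q i \<noteq> 0}"] ratvec_c00) (auto simp: Vset_def)
  then show ?thesis by (simp add: LIMSEQ_const_iff)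
qed

lemma seminormed_mu_bar:
  assumes mu: "seminorm_V \<mu>"
  shows "seminormed c00 (mu_bar \<mu>)"
proof
  show "subspace c00" by (rule subspace_c00)
next
  fix x y assume x: "x \<in> c00" and y: "y \<in> c00"
  obtain a where a: "\<And>k. a k \<in> Vset" "\<And>k i. x i = 0 \<Longrightarrow> a k i = 0"
    "\<And>i. (\<lambda>k. of_rat (a k i)) \<longlonglongrightarrow> x i" using c00_approx_rat[OF x] by blast
  obtain b where b: "\<And>k. b k \<in> Vset" "\<And>k i. y i = 0 \<Longrightarrow> b k i = 0"
    "\<And>i. (\<lambda>k. of_rat (b k i)) \<longlonglongrightarrow> y i" using c00_approx_rat[OF y] by blast
  have fin: "finite {i. x i \<noteq> 0}" "finite {i. y i \<noteq> 0}" using x y by (auto simp: c00_def)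
  show "mu_bar \<mu> (x + y) \<le> mu_bar \<mu> x + mu_bar \<mu> y"
  proof (rule tendsto_le[OF sequentially_bot])
    show "(\<lambda>k. \<mu> (a k) + \<mu> (b k)) \<longlonglongrightarrow> mu_bar \<mu> x + mu_bar \<mu> y"
      using a b fin
      by (intro tendsto_add mu_bar_tendsto[OF mu x, of "{i. x i \<noteq> 0}"]
          mu_bar_tendsto[OF mu y, of "{i. y i \<noteq> 0}"]) auto
    show "(\<lambda>k. \<mu> (\<lambda>i. a k i + b k i)) \<longlonglongrightarrow> mu_bar \<mu> (x + y)"
    proof (rule mu_bar_tendsto[OF mu, of _ "{i. x i \<noteq> 0} \<union> {i. y i \<noteq> 0}"])
      show "x + y \<in> c00" using subspace_c00 x y by (rule subspace_add)
    qed (use a b fin in \<open>auto simp: of_rat_add intro: tendsto_add\<close>)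
    show "\<forall>\<^sub>F k in sequentially. \<mu> (\<lambda>i. a k i + b k i) \<le> \<mu> (a k) + \<mu> (b k)"
      by (intro always_eventually allI seminorm_V_add[OF mu] a b)
  qed
next
  fix c :: real and x assume x: "x \<in> c00"
  obtain a where a: "\<And>k. a k \<in> Vset" "\<And>k i. x i = 0 \<Longrightarrow> a k i = 0"
    "\<And>i. (\<lambda>k. of_rat (a k i)) \<longlonglongrightarrow> x i" using c00_approx_rat[OF x] by blast
  \<comment> \<open>The scalar is viewed as a vector supported at 0, so that the vector lemma also
    yields rationals converging to \<open>c\<close>.\<close>
  have "(\<lambda>i::nat. if i = 0 then c else 0) \<in> c00" by (simp add: c00_def)
  from c00_approx_rat[OF this] obtain b :: "nat \<Rightarrow> rat" where b: "(\<lambda>k. of_rat (b k)) \<longlonglongrightarrow> c"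
    by (metis (full_types))
  have fin: "finite {i. x i \<noteq> 0}" using x by (auto simp: c00_def)
  have "(\<lambda>k. \<bar>of_rat (b k)\<bar> * \<mu> (a k)) \<longlonglongrightarrow> \<bar>c\<bar> * mu_bar \<mu> x"
    using a fin by (intro tendsto_intros b mu_bar_tendsto[OF mu x, of "{i. x i \<noteq> 0}"]) auto
  moreover have "\<bar>of_rat (b k)\<bar> * \<mu> (a k) = \<mu> (\<lambda>i. b k * a k i)" for k
    by (rule seminorm_V_scale[OF mu a(1), symmetric])
  moreover have "(\<lambda>k. \<mu> (\<lambda>i. b k * a k i)) \<longlonglongrightarrow> mu_bar \<mu> (c *\<^sub>R x)"
  proof (rule mu_bar_tendsto[OF mu, of _ "{i. x i \<noteq> 0}"])
    show "c *\<^sub>R x \<in> c00" using subspace_c00 x by (rule subspace_scale)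
  qed (use a b fin in \<open>auto simp: of_rat_mult intro: tendsto_mult\<close>)
  ultimately show "mu_bar \<mu> (c *\<^sub>R x) = \<bar>c\<bar> * mu_bar \<mu> x"
    using LIMSEQ_unique by auto
qed

lemma c00_expand:
  assumes "finite T" and "\<And>i. i \<notin> T \<Longrightarrow> x i = 0"
  shows "x = (\<Sum>i\<in>T. x i *\<^sub>R ratvec (unit_V i))"
proof
  fix j
  have "(\<Sum>i\<in>T. x i *\<^sub>R ratvec (unit_V i)) j = (\<Sum>i\<in>T. if i = j then x j else 0)"
    unfolding sum_fun_apply by (intro sum.cong) (auto simp: unit_V_def)
  also have "\<dots> = x j" using assms by auto
  finally show "x j = (\<Sum>i\<in>T. x i *\<^sub>R ratvec (unit_V i)) j" ..
qed

text \<open>On a fixed finite support any seminorm is dominated by a weighted l_1 norm. The general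
  \<open>p\<close> covers both \<open>mu_bar\<close> and \<open>mixnorm\<close>.\<close>

lemma seminormed_c00_tendsto:
  assumes "seminormed c00 p" and T: "finite T"
    and a: "\<And>k i. i \<notin> T \<Longrightarrow> a k i = 0" and x: "\<And>i. i \<notin> T \<Longrightarrow> x i = 0"
    and lim: "\<And>i. (\<lambda>k. of_rat (a k i)) \<longlonglongrightarrow> x i"
  shows "(\<lambda>k. p (x - ratvec (a k))) \<longlonglongrightarrow> 0"
proof (rule tendsto_sandwich[OF _ _ tendsto_const])
  interpret seminormed c00 p by fact
  define w where "w i = ratvec (unit_V i)" for i
  have w: "w i \<in> c00" for i unfolding w_def by (intro ratvec_c00 unit_V_Vset)
  have wz: "c *\<^sub>R w i \<in> c00" for c i using subspace w by (rule subspace_scale)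
  have eq: "x - ratvec (a k) = (\<Sum>i\<in>T. (x i - of_rat (a k i)) *\<^sub>R w i)" for k
    using c00_expand[OF T, of "x - ratvec (a k)"] a x by (simp add: w_def)
  have "p (x - ratvec (a k)) \<le> (\<Sum>i\<in>T. p ((x i - of_rat (a k i)) *\<^sub>R w i))" for k
    unfolding eq by (rule p_sum_le) (rule wz)
  then show "\<forall>\<^sub>F k in sequentially. p (x - ratvec (a k)) \<le> (\<Sum>i\<in>T. \<bar>x i - of_rat (a k i)\<bar> * p (w i))"
    by (simp add: scale w)
  show "\<forall>\<^sub>F k in sequentially. 0 \<le> p (x - ratvec (a k))"
    unfolding eq using subspace wz by (intro always_eventually allI p_nonneg subspace_sum)
  have "(\<lambda>k. \<Sum>i\<in>T. \<bar>x i - of_rat (a k i)\<bar> * p (w i)) \<longlonglongrightarrow> (\<Sum>i\<in>T. \<bar>x i - x i\<bar> * p (w i))"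
    by (intro tendsto_intros lim)
  then show "(\<lambda>k. \<Sum>i\<in>T. \<bar>x i - of_rat (a k i)\<bar> * p (w i)) \<longlonglongrightarrow> 0" by simp
qed

lemma mu_bar_dense:
  assumes mu: "seminorm_V \<mu>" and x: "x \<in> c00" and d: "0 < d"
  shows "\<exists>q\<in>Vset. mu_bar \<mu> (x - ratvec q) < d"
proof -
  obtain a where a: "\<And>k. a k \<in> Vset" "\<And>k i. x i = 0 \<Longrightarrow> a k i = 0"
    "\<And>i. (\<lambda>k. of_rat (a k i)) \<longlonglongrightarrow> x i" using c00_approx_rat[OF x] by blast
  have "(\<lambda>k. mu_bar \<mu> (x - ratvec (a k))) \<longlonglongrightarrow> 0"
    using a x by (intro seminormed_c00_tendsto[of _ "{i. x i \<noteq> 0}"] seminormed_mu_bar[OF mu])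
      (auto simp: c00_def)
  then have "\<forall>\<^sub>F k in sequentially. mu_bar \<mu> (x - ratvec (a k)) < d"
    using d by (rule order_tendstoD(2))
  then show ?thesis using a(1) by (auto simp: eventually_sequentially)
qed

section \<open>The completion\<close>

text \<open>The norm of the completion before the quotient: \<open>xnorm\<close> of a class is this
  value at the chosen representative.\<close>

definition seqnorm :: "((nat \<Rightarrow> rat) \<Rightarrow> real) \<Rightarrow> (nat \<Rightarrow> nat \<Rightarrow> real) \<Rightarrow> real" where
  "seqnorm \<mu> s = lim (\<lambda>n. mu_bar \<mu> (s n))"

definition constseq :: "(nat \<Rightarrow> rat) \<Rightarrow> nat \<Rightarrow> nat \<Rightarrow> real" where
  "constseq q = (\<lambda>n. ratvec q)"

lemma lambda_seq_ops:
  fixes s t :: "nat \<Rightarrow> nat \<Rightarrow> real"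
  shows "(\<lambda>n i. s n i + t n i) = s + t" "(\<lambda>n i. a * s n i) = a *\<^sub>R s" "(\<lambda>n i. 0::real) = (0 :: nat \<Rightarrow> nat \<Rightarrow> real)"
  by (auto simp: fun_eq_iff)

text \<open>A rank condition on finite sets of rational vectors, with real coefficients allowed. It
  does not mention \<open>\<mu>\<close>, so the same countable collection of tests applies to every
  seminorm.\<close>

definition rank_family :: "nat \<Rightarrow> (nat \<Rightarrow> rat) set set" where
  "rank_family n = {F. finite F \<and> F \<subseteq> Vset \<and>
     (\<exists>q. (\<forall>i<n. q i \<in> Vset) \<and> (\<forall>x\<in>F. \<exists>c. ratvec x = lincomb n c (\<lambda>i. ratvec (q i))))}"

text \<open>Octahedrality read off from the values of \<open>\<mu>\<close> on \<open>Vset\<close>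
  alone. By strictness and finiteness of \<open>F\<close>, a witness \<open>r\<close> persists under
  small changes of \<open>\<mu>\<close> in \<open>RV\<close>.\<close>

definition V_octahedral :: "nat \<Rightarrow> ((nat \<Rightarrow> rat) \<Rightarrow> real) \<Rightarrow> bool" where
  "V_octahedral n \<mu> \<longleftrightarrow> (\<forall>F\<in>rank_family n. \<forall>k::nat. \<exists>r\<in>Vset.
     \<bar>\<mu> r - 1\<bar> < 1 / Suc k \<and> (\<forall>x\<in>F. \<mu> x + 1 - 1 / Suc k < \<mu> (\<lambda>i. x i + r i)))"

locale coded =
  fixes \<mu> :: "(nat \<Rightarrow> rat) \<Rightarrow> real"
  assumes mu: "seminorm_V \<mu>"
begin

sublocale bar: seminormed c00 "mu_bar \<mu>"
  by (rule seminormed_mu_bar[OF mu])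

lemma mu_cauchy_iff:
  "mu_cauchy \<mu> s \<longleftrightarrow> (\<forall>n. s n \<in> c00) \<and>
     (\<forall>\<epsilon>>0. \<exists>N. \<forall>m\<ge>N. \<forall>n\<ge>N. mu_bar \<mu> (s m - s n) < \<epsilon>)"
  by (simp add: mu_cauchy_def fun_diff_def)

lemma seqnorm_lim:
  assumes "mu_cauchy \<mu> s"
  shows "(\<lambda>n. mu_bar \<mu> (s n)) \<longlonglongrightarrow> seqnorm \<mu> s"
proof -
  have c: "s n \<in> c00" for n using assms by (simp add: mu_cauchy_iff)
  have "Cauchy (\<lambda>n. mu_bar \<mu> (s n))"
  proof (rule metric_CauchyI)
    fix e :: real assume "e > 0"
    then obtain N where "\<forall>m\<ge>N. \<forall>n\<ge>N. mu_bar \<mu> (s m - s n) < e"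
      using assms by (auto simp: mu_cauchy_iff)
    then have "\<forall>m\<ge>N. \<forall>n\<ge>N. dist (mu_bar \<mu> (s m)) (mu_bar \<mu> (s n)) < e"
      using bar.p_abs_diff_le[OF c c] unfolding dist_real_def by (meson le_less_trans)
    then show "\<exists>N. \<forall>m\<ge>N. \<forall>n\<ge>N. dist (mu_bar \<mu> (s m)) (mu_bar \<mu> (s n)) < e" by blast
  qed
  then show ?thesis by (simp add: Cauchy_convergent_iff convergent_LIMSEQ_iff seqnorm_def)
qed

lemma seqnorm_eqI: "(\<lambda>n. mu_bar \<mu> (s n)) \<longlonglongrightarrow> r \<Longrightarrow> seqnorm \<mu> s = r"
  unfolding seqnorm_def by (rule limI)

lemma mu_cauchy_const: "x \<in> c00 \<Longrightarrow> mu_cauchy \<mu> (\<lambda>n. x)"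
  by (simp add: mu_cauchy_iff)

lemma seqnorm_const: "seqnorm \<mu> (\<lambda>n. x) = mu_bar \<mu> x"
  by (rule seqnorm_eqI) simp

lemma mu_cauchy_add:
  assumes s: "mu_cauchy \<mu> s" and t: "mu_cauchy \<mu> t"
  shows "mu_cauchy \<mu> (s + t)"
  unfolding mu_cauchy_iff
proof (intro conjI allI impI)
  fix n show "(s + t) n \<in> c00"
    using s t bar.subspace by (simp add: mu_cauchy_iff subspace_add)
next
  fix \<epsilon> :: real assume "\<epsilon> > 0"
  then have "\<epsilon> / 2 > 0" by simp
  then obtain N1 N2 where N: "\<forall>m\<ge>N1. \<forall>n\<ge>N1. mu_bar \<mu> (s m - s n) < \<epsilon>/2"
    "\<forall>m\<ge>N2. \<forall>n\<ge>N2. mu_bar \<mu> (t m - t n) < \<epsilon>/2"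
    using s t by (meson mu_cauchy_iff)
  have "mu_bar \<mu> ((s + t) m - (s + t) n) < \<epsilon>" if "m \<ge> max N1 N2" "n \<ge> max N1 N2" for m n
  proof -
    have eq: "(s + t) m - (s + t) n = (s m - s n) + (t m - t n)" by simp
    have "mu_bar \<mu> ((s + t) m - (s + t) n) \<le> mu_bar \<mu> (s m - s n) + mu_bar \<mu> (t m - t n)"
      unfolding eq using s t bar.subspace
      by (intro bar.triangle subspace_diff) (auto simp: mu_cauchy_iff)
    also have "\<dots> < \<epsilon>/2 + \<epsilon>/2" using N that by (intro add_strict_mono) auto
    finally show ?thesis by simp
  qed
  then show "\<exists>N. \<forall>m\<ge>N. \<forall>n\<ge>N. mu_bar \<mu> ((s + t) m - (s + t) n) < \<epsilon>" by blast
qed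

lemma mu_cauchy_scale:
  assumes s: "mu_cauchy \<mu> s"
  shows "mu_cauchy \<mu> (a *\<^sub>R s)"
  unfolding mu_cauchy_iff
proof (intro conjI allI impI)
  fix n show "(a *\<^sub>R s) n \<in> c00"
    using s bar.subspace by (simp add: mu_cauchy_iff subspace_scale)
next
  fix \<epsilon> :: real assume \<epsilon>: "\<epsilon> > 0"
  then have "\<epsilon> / (\<bar>a\<bar> + 1) > 0" by (simp add: add_nonneg_pos)
  then obtain N where N: "\<forall>m\<ge>N. \<forall>n\<ge>N. mu_bar \<mu> (s m - s n) < \<epsilon> / (\<bar>a\<bar> + 1)"
    using s by (meson mu_cauchy_iff)
  have "mu_bar \<mu> ((a *\<^sub>R s) m - (a *\<^sub>R s) n) < \<epsilon>" if "m \<ge> N" "n \<ge> N" for m n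
  proof -
    have c: "s m - s n \<in> c00" using s bar.subspace by (simp add: mu_cauchy_iff subspace_diff)
    have "(a *\<^sub>R s) m - (a *\<^sub>R s) n = a *\<^sub>R (s m - s n)" by (simp add: scaleR_diff_right)
    then have "mu_bar \<mu> ((a *\<^sub>R s) m - (a *\<^sub>R s) n) = \<bar>a\<bar> * mu_bar \<mu> (s m - s n)"
      using bar.scale[OF c] by simp
    also have "\<dots> \<le> \<bar>a\<bar> * (\<epsilon> / (\<bar>a\<bar> + 1))"
      using N that by (intro mult_left_mono) (auto intro: less_imp_le)
    also have "\<dots> < \<epsilon>" using \<epsilon> by (simp add: field_simps)
    finally show ?thesis .
  qed
  then show "\<exists>N. \<forall>m\<ge>N. \<forall>n\<ge>N. mu_bar \<mu> ((a *\<^sub>R s) m - (a *\<^sub>R s) n) < \<epsilon>" by blast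
qed

lemma constseq_cauchy: "q \<in> Vset \<Longrightarrow> mu_cauchy \<mu> (constseq q)"
  unfolding constseq_def by (intro mu_cauchy_const ratvec_c00)

lemma seqnorm_constseq: "q \<in> Vset \<Longrightarrow> seqnorm \<mu> (constseq q) = \<mu> q"
  unfolding constseq_def by (simp add: seqnorm_const mu_bar_ratvec[OF mu])

sublocale seminormed "{s. mu_cauchy \<mu> s}" "seqnorm \<mu>"
proof
  show "subspace {s. mu_cauchy \<mu> s}"
  proof (rule subspaceI)
    have "(\<lambda>n::nat. (0::nat \<Rightarrow> real)) = 0" by (simp add: fun_eq_iff)
    then show "0 \<in> {s. mu_cauchy \<mu> s}"
      using mu_cauchy_const[of 0] subspace_0[OF subspace_c00] by simp
  qed (simp_all add: mu_cauchy_add mu_cauchy_scale)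
next
  fix s t assume "s \<in> {s. mu_cauchy \<mu> s}" "t \<in> {s. mu_cauchy \<mu> s}"
  then have st: "mu_cauchy \<mu> s" "mu_cauchy \<mu> t" by auto
  show "seqnorm \<mu> (s + t) \<le> seqnorm \<mu> s + seqnorm \<mu> t"
    by (rule tendsto_le[OF sequentially_bot tendsto_add[OF seqnorm_lim[OF st(1)] seqnorm_lim[OF st(2)]]
        seqnorm_lim[OF mu_cauchy_add[OF st]]])
      (use st in \<open>auto simp: mu_cauchy_iff intro!: always_eventually bar.triangle\<close>)
next
  fix a s assume "s \<in> {s. mu_cauchy \<mu> s}"
  then have s: "mu_cauchy \<mu> s" by auto
  have "(\<lambda>n. \<bar>a\<bar> * mu_bar \<mu> (s n)) \<longlonglongrightarrow> \<bar>a\<bar> * seqnorm \<mu> s"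
    by (intro tendsto_mult_left seqnorm_lim[OF s])
  moreover have "\<bar>a\<bar> * mu_bar \<mu> (s n) = mu_bar \<mu> ((a *\<^sub>R s) n)" for n
    using s by (simp add: mu_cauchy_iff bar.scale)
  ultimately show "seqnorm \<mu> (a *\<^sub>R s) = \<bar>a\<bar> * seqnorm \<mu> s" by (intro seqnorm_eqI) simp
qed

sublocale dense_seminormed "{s. mu_cauchy \<mu> s}" "seqnorm \<mu>" "constseq ` Vset"
proof
  show "constseq ` Vset \<subseteq> {s. mu_cauchy \<mu> s}" using constseq_cauchy by auto
next
  fix s and \<delta> :: real assume "s \<in> {s. mu_cauchy \<mu> s}" and \<delta>: "0 < \<delta>"
  then have s: "mu_cauchy \<mu> s" by simp
  have "\<delta>/4 > 0" using \<delta> by simp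
  then obtain N where N: "\<forall>m\<ge>N. \<forall>n\<ge>N. mu_bar \<mu> (s m - s n) < \<delta>/4"
    using s by (meson mu_cauchy_iff)
  have c: "s n \<in> c00" for n using s by (simp add: mu_cauchy_iff)
  obtain q where q: "q \<in> Vset" "mu_bar \<mu> (s N - ratvec q) < \<delta>/4"
    using mu_bar_dense[OF mu c \<open>\<delta>/4 > 0\<close>] by blast
  have "mu_cauchy \<mu> (s - constseq q)"
    using subspace_diff[OF subspace, of s "constseq q"] s constseq_cauchy[OF q(1)] by simp
  note seqnorm_lim[OF this]
  moreover have "mu_bar \<mu> ((s - constseq q) n) \<le> \<delta>/2" if "n \<ge> N" for n
  proof -
    have "mu_bar \<mu> (s n - ratvec q) \<le> mu_bar \<mu> (s n - s N) + mu_bar \<mu> (s N - ratvec q)"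
      using c ratvec_c00[OF q(1)] by (intro bar.p_triangle_diff)
    moreover have "mu_bar \<mu> (s n - s N) < \<delta>/4" using N that by simp
    ultimately show ?thesis using q(2) by (simp add: constseq_def)
  qed
  ultimately have "seqnorm \<mu> (s - constseq q) \<le> \<delta>/2"
    by (intro LIMSEQ_le_const2) blast+
  then show "\<exists>d\<in>constseq ` Vset. seqnorm \<mu> (s - d) < \<delta>" using q(1) \<delta> by force
next
  have "(\<lambda>i. 0) \<in> Vset" by (simp add: Vset_def)
  moreover have "constseq (\<lambda>i. 0) = 0" by (simp add: constseq_def fun_eq_iff)
  ultimately show "0 \<in> constseq ` Vset" by (metis imageI)
next
  fix x y assume "x \<in> constseq ` Vset" "y \<in> constseq ` Vset"
  then obtain q r where qr: "q \<in> Vset" "r \<in> Vset" "x = constseq q" "y = constseq r" by auto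
  have "x + y = constseq (\<lambda>i. q i + r i)"
    using qr by (simp add: constseq_def fun_eq_iff of_rat_add)
  then show "x + y \<in> constseq ` Vset" using Vset_add[OF qr(1,2)] by blast
next
  fix a x assume "x \<in> constseq ` Vset"
  then obtain q where q: "q \<in> Vset" "x = constseq q" by auto
  have "of_rat a *\<^sub>R x = constseq (\<lambda>i. a * q i)"
    using q by (simp add: constseq_def fun_eq_iff of_rat_mult)
  then show "of_rat a *\<^sub>R x \<in> constseq ` Vset" using Vset_scale[OF q(1)] by blast
qed

section \<open>Passage from Cauchy sequences to their classes\<close>

lemma mu_rel_iff:
  "(s, t) \<in> mu_rel \<mu> \<longleftrightarrow> mu_cauchy \<mu> s \<and> mu_cauchy \<mu> t \<and> seqnorm \<mu> (s - t) = 0"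
proof -
  have "(\<lambda>n. mu_bar \<mu> (s n - t n)) \<longlonglongrightarrow> 0 \<longleftrightarrow> seqnorm \<mu> (s - t) = 0"
    if "mu_cauchy \<mu> s" "mu_cauchy \<mu> t"
  proof -
    have "mu_cauchy \<mu> (s - t)" using subspace_diff[OF subspace, of s t] that by simp
    from seqnorm_lim[OF this] show ?thesis using LIMSEQ_unique by force
  qed
  then show ?thesis by (auto simp: mu_rel_def fun_diff_def)
qed

lemma equiv_mu_rel: "equiv {s. mu_cauchy \<mu> s} (mu_rel \<mu>)"
proof (rule equivI)
  show "mu_rel \<mu> \<subseteq> {s. mu_cauchy \<mu> s} \<times> {s. mu_cauchy \<mu> s}" by (auto simp: mu_rel_iff)
  show "refl_on {s. mu_cauchy \<mu> s} (mu_rel \<mu>)" by (auto simp: refl_on_def mu_rel_iff)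
  show "sym (mu_rel \<mu>)" by (auto simp: sym_def mu_rel_iff p_diff_commute)
  show "trans (mu_rel \<mu>)"
  proof (rule transI)
    fix s t u assume "(s, t) \<in> mu_rel \<mu>" "(t, u) \<in> mu_rel \<mu>"
    then have c: "mu_cauchy \<mu> s" "mu_cauchy \<mu> t" "mu_cauchy \<mu> u"
      and z: "seqnorm \<mu> (s - t) = 0" "seqnorm \<mu> (t - u) = 0" by (auto simp: mu_rel_iff)
    have "seqnorm \<mu> (s - u) \<le> 0" using p_triangle_diff[of s t u] c z by simp
    moreover have "0 \<le> seqnorm \<mu> (s - u)"
      using c subspace by (intro p_nonneg subspace_diff) auto
    ultimately show "(s, u) \<in> mu_rel \<mu>" using c by (simp add: mu_rel_iff)
  qed
qed

definition cls :: "(nat \<Rightarrow> nat \<Rightarrow> real) \<Rightarrow> (nat \<Rightarrow> nat \<Rightarrow> real) set" where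
  "cls s = mu_rel \<mu> `` {s}"

lemma cls_eq_iff:
  "mu_cauchy \<mu> s \<Longrightarrow> mu_cauchy \<mu> t \<Longrightarrow> cls s = cls t \<longleftrightarrow> seqnorm \<mu> (s - t) = 0"
  unfolding cls_def using eq_equiv_class_iff[OF equiv_mu_rel, of s t] by (simp add: mu_rel_iff)

lemma Xmu_eq: "Xmu \<mu> = cls ` {s. mu_cauchy \<mu> s}"
  by (auto simp: Xmu_def quotient_def cls_def)

text \<open>All that is ever known about the choice made by \<open>rep\<close>: it changes a
  sequence only by an element of the kernel. The operations on classes are computed from
  this.\<close>

lemma rep_cls:
  assumes "mu_cauchy \<mu> s"
  shows "mu_cauchy \<mu> (rep (cls s))" "seqnorm \<mu> (rep (cls s) - s) = 0"
proof -
  have "s \<in> cls s" using assms by (simp add: cls_def mu_rel_iff)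
  then have "rep (cls s) \<in> cls s" unfolding rep_def by (rule someI[of "\<lambda>t. t \<in> cls s"])
  then have "(s, rep (cls s)) \<in> mu_rel \<mu>" by (simp add: cls_def)
  then show "mu_cauchy \<mu> (rep (cls s))" "seqnorm \<mu> (rep (cls s) - s) = 0"
    using assms p_diff_commute by (auto simp: mu_rel_iff)
qed

lemma xnorm_cls:
  assumes "mu_cauchy \<mu> s"
  shows "xnorm \<mu> (cls s) = seqnorm \<mu> s"
  using p_abs_diff_le[of "rep (cls s)" s] rep_cls[OF assms] assms
  by (simp add: xnorm_def flip: seqnorm_def)

lemma xadd_cls:
  assumes s: "mu_cauchy \<mu> s" and t: "mu_cauchy \<mu> t"
  shows "xadd \<mu> (cls s) (cls t) = cls (s + t)"
proof -
  note rs = rep_cls[OF s] and rt = rep_cls[OF t]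
  have eq: "rep (cls s) + rep (cls t) - (s + t) = (rep (cls s) - s) + (rep (cls t) - t)" by simp
  have d: "rep (cls s) - s \<in> {s. mu_cauchy \<mu> s}" "rep (cls t) - t \<in> {s. mu_cauchy \<mu> s}"
    using subspace_diff[OF subspace, of "rep (cls s)" s] subspace_diff[OF subspace, of "rep (cls t)" t]
      s t rs rt by simp_all
  have "seqnorm \<mu> (rep (cls s) + rep (cls t) - (s + t)) \<le> 0"
    unfolding eq using triangle[OF d] rs rt by simp
  moreover have "0 \<le> seqnorm \<mu> (rep (cls s) + rep (cls t) - (s + t))"
    unfolding eq using subspace_add[OF subspace d] by (rule p_nonneg)
  ultimately show ?thesis
    unfolding xadd_def lambda_seq_ops
    using cls_eq_iff[of "rep (cls s) + rep (cls t)" "s + t"] s t rs rt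
    by (simp add: mu_cauchy_add flip: cls_def)
qed

lemma xscale_cls:
  assumes s: "mu_cauchy \<mu> s"
  shows "xscale \<mu> a (cls s) = cls (a *\<^sub>R s)"
proof -
  note rs = rep_cls[OF s]
  have d: "rep (cls s) - s \<in> {s. mu_cauchy \<mu> s}"
    using subspace_diff[OF subspace, of "rep (cls s)" s] s rs by simp
  have "seqnorm \<mu> (a *\<^sub>R rep (cls s) - a *\<^sub>R s) = 0"
    using scale[OF d, of a] rs by (simp add: scaleR_diff_right)
  then show ?thesis
    unfolding xscale_def lambda_seq_ops
    using cls_eq_iff[of "a *\<^sub>R rep (cls s)" "a *\<^sub>R s"] s rs
    by (simp add: mu_cauchy_scale flip: cls_def)
qed

lemma xzero_cls: "xzero \<mu> = cls 0"
  unfolding xzero_def lambda_seq_ops cls_def ..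

lemma mu_cauchy_lincomb: "(\<And>i. i < n \<Longrightarrow> mu_cauchy \<mu> (e i)) \<Longrightarrow> mu_cauchy \<mu> (lincomb n c e)"
  using lincomb_in[of n e c] by simp

lemma xsum_cls:
  assumes "\<And>i. i < n \<Longrightarrow> mu_cauchy \<mu> (e i)" and "\<And>i. i < n \<Longrightarrow> E i = cls (e i)"
  shows "xsum \<mu> n c E = cls (lincomb n c e)"
  using assms
proof (induction n)
  case 0
  then show ?case by (simp add: xzero_cls lincomb_def zero_fun_def)
next
  case (Suc n)
  have "xsum \<mu> (Suc n) c E = xadd \<mu> (cls (lincomb n c e)) (cls (c n *\<^sub>R e n))"
    using Suc by (simp add: xscale_cls)
  also have "\<dots> = cls (lincomb n c e + c n *\<^sub>R e n)"
    using Suc.prems by (intro xadd_cls mu_cauchy_lincomb mu_cauchy_scale) auto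
  finally show ?case unfolding lincomb_Suc .
qed

lemma octahedral_cls:
  assumes "\<And>i. i < n \<Longrightarrow> mu_cauchy \<mu> (e i)"
  shows "(\<exists>y\<in>Xmu \<mu>. xnorm \<mu> y = 1 \<and>
        (\<forall>c. xnorm \<mu> (xadd \<mu> (xsum \<mu> n c (\<lambda>i. cls (e i))) y)
               \<ge> (1 - \<epsilon>) * (xnorm \<mu> (xsum \<mu> n c (\<lambda>i. cls (e i))) + xnorm \<mu> y))) \<longleftrightarrow>
     (\<exists>y\<in>{s. mu_cauchy \<mu> s}. seqnorm \<mu> y = 1 \<and>
        (\<forall>c. (1 - \<epsilon>) * (seqnorm \<mu> (lincomb n c e) + 1) \<le> seqnorm \<mu> (lincomb n c e + y)))"
proof -
  have s: "xsum \<mu> n c (\<lambda>i. cls (e i)) = cls (lincomb n c e)" for c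
    using assms by (intro xsum_cls) auto
  have l: "mu_cauchy \<mu> (lincomb n c e)" for c using assms by (rule mu_cauchy_lincomb)
  show ?thesis
    unfolding s Xmu_eq by (auto simp: xnorm_cls l xadd_cls mu_cauchy_add)
qed

lemma OH_iff_octahedral: "OH \<mu> \<longleftrightarrow> (\<forall>n. octahedral n)"
proof
  assume OH: "OH \<mu>"
  show "\<forall>n. octahedral n"
    unfolding octahedral_def
  proof (intro allI impI)
    fix n :: nat and \<epsilon> e assume *: "(0::real) < \<epsilon>" "\<forall>i<n. e i \<in> {s. mu_cauchy \<mu> s}"
    then have "\<forall>i<n. cls (e i) \<in> Xmu \<mu>" by (simp add: Xmu_eq)
    with OH[unfolded OH_def, rule_format, OF *(1), of n "\<lambda>i. cls (e i)"] *
    show "\<exists>y\<in>{s. mu_cauchy \<mu> s}. seqnorm \<mu> y = 1 \<and>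
        (\<forall>c. (1 - \<epsilon>) * (seqnorm \<mu> (lincomb n c e) + 1) \<le> seqnorm \<mu> (lincomb n c e + y))"
      by (subst octahedral_cls[symmetric]) auto
  qed
next
  assume oct: "\<forall>n. octahedral n"
  show "OH \<mu>"
    unfolding OH_def
  proof (intro allI impI)
    fix \<epsilon> :: real and n :: nat and E assume \<epsilon>: "0 < \<epsilon>" and E: "\<forall>i<n. E i \<in> Xmu \<mu>"
    \<comment> \<open>\<open>E\<close> consists of elements of the completion only below n;
      \<open>xsum\<close> reads no further entries, so representatives are picked just
      there.\<close>
    then have "\<forall>i. \<exists>s. i < n \<longrightarrow> mu_cauchy \<mu> s \<and> E i = cls s" by (auto simp: Xmu_eq)
    then obtain e where e: "\<And>i. i < n \<Longrightarrow> mu_cauchy \<mu> (e i)" "\<And>i. i < n \<Longrightarrow> E i = cls (e i)"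
      by metis
    have "xsum \<mu> n c E = xsum \<mu> n c (\<lambda>i. cls (e i))" for c
      using xsum_cls[of n e E c] xsum_cls[of n e "\<lambda>i. cls (e i)" c] e by simp
    then show "\<exists>y\<in>Xmu \<mu>. xnorm \<mu> y = 1 \<and>
        (\<forall>c. xnorm \<mu> (xadd \<mu> (xsum \<mu> n c E) y) \<ge> (1 - \<epsilon>) * (xnorm \<mu> (xsum \<mu> n c E) + xnorm \<mu> y))"
      using octahedral_cls[of n e \<epsilon>] e(1) oct[unfolded octahedral_def, rule_format, OF \<epsilon>, of n e]
      by simp
  qed
qed

lemma LOH_iff_octahedral: "LOH \<mu> \<longleftrightarrow> octahedral 1"
proof -
  have one: "lincomb 1 c e = c 0 *\<^sub>R e 0" for c and e :: "nat \<Rightarrow> nat \<Rightarrow> nat \<Rightarrow> real"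
    by (simp add: lincomb_def)
  have "octahedral 1 \<longleftrightarrow> (\<forall>\<epsilon>>0. \<forall>s. mu_cauchy \<mu> s \<longrightarrow> (\<exists>y. mu_cauchy \<mu> y \<and> seqnorm \<mu> y = 1 \<and>
     (\<forall>t. (1 - \<epsilon>) * (\<bar>t\<bar> * seqnorm \<mu> s + 1) \<le> seqnorm \<mu> (t *\<^sub>R s + y))))" (is "_ \<longleftrightarrow> ?R")
  proof
    assume oct: "octahedral 1"
    show ?R
    proof (intro allI impI)
      fix \<epsilon> :: real and s assume \<epsilon>: "0 < \<epsilon>" and s: "mu_cauchy \<mu> s"
      obtain y where y: "mu_cauchy \<mu> y" "seqnorm \<mu> y = 1"
        "\<forall>c::nat \<Rightarrow> real. (1 - \<epsilon>) * (seqnorm \<mu> (c 0 *\<^sub>R s) + 1) \<le> seqnorm \<mu> (c 0 *\<^sub>R s + y)"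
        using oct[unfolded octahedral_def one, rule_format, OF \<epsilon>, of "\<lambda>_. s"] s by auto
      have "(1 - \<epsilon>) * (\<bar>t\<bar> * seqnorm \<mu> s + 1) \<le> seqnorm \<mu> (t *\<^sub>R s + y)" for t
        using y(3)[rule_format, of "\<lambda>_. t"] scale[of s t] s by simp
      with y show "\<exists>y. mu_cauchy \<mu> y \<and> seqnorm \<mu> y = 1 \<and>
        (\<forall>t. (1 - \<epsilon>) * (\<bar>t\<bar> * seqnorm \<mu> s + 1) \<le> seqnorm \<mu> (t *\<^sub>R s + y))" by blast
    qed
  next
    assume R: ?R
    show "octahedral 1"
      unfolding octahedral_def one
    proof (intro allI impI)
      fix \<epsilon> :: real and e :: "nat \<Rightarrow> nat \<Rightarrow> nat \<Rightarrow> real" assume \<epsilon>: "0 < \<epsilon>" and "\<forall>i<1. e i \<in> {s. mu_cauchy \<mu> s}"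
      then have e: "mu_cauchy \<mu> (e 0)" by simp
      from R \<epsilon> e obtain y where "mu_cauchy \<mu> y" "seqnorm \<mu> y = 1"
        "\<forall>t. (1 - \<epsilon>) * (\<bar>t\<bar> * seqnorm \<mu> (e 0) + 1) \<le> seqnorm \<mu> (t *\<^sub>R e 0 + y)" by blast
      then show "\<exists>y\<in>{s. mu_cauchy \<mu> s}. seqnorm \<mu> y = 1 \<and> (\<forall>c. (1 - \<epsilon>) *
          (seqnorm \<mu> (c 0 *\<^sub>R e 0) + 1) \<le> seqnorm \<mu> (c 0 *\<^sub>R e 0 + y))"
        using scale[of "e 0"] e by auto
    qed
  qed
  then show ?thesis
    unfolding LOH_def Xmu_eq
    by (simp add: xnorm_cls xscale_cls xadd_cls mu_cauchy_scale mu_cauchy_add cong: conj_cong)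
qed

text \<open>The classes of the unit vectors are independent: a vanishing combination is represented
  by a constant sequence at a vector of norm 0.\<close>

lemma infinite_dim_if_norm:
  assumes norm: "\<And>x. x \<in> c00 \<Longrightarrow> mu_bar \<mu> x = 0 \<Longrightarrow> x = 0"
  shows "infinite_dim \<mu>"
  unfolding infinite_dim_def
proof
  fix n
  define e where "e i = constseq (unit_V i)" for i
  have e: "mu_cauchy \<mu> (e i)" for i unfolding e_def by (intro constseq_cauchy unit_V_Vset)
  have "c j = 0" if c: "xsum \<mu> n c (\<lambda>i. cls (e i)) = xzero \<mu>" and j: "j < n" for c j
  proof -
    define x where "x = lincomb n c (\<lambda>i. ratvec (unit_V i))"
    have x: "x \<in> c00" unfolding x_def by (intro bar.lincomb_in ratvec_c00 unit_V_Vset)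
    have lc: "lincomb n c e = (\<lambda>_. x)"
      by (simp add: fun_eq_iff x_def e_def lincomb_def constseq_def sum_fun_apply)
    have "cls (lincomb n c e) = cls 0" using c e xsum_cls[of n e] by (simp add: xzero_cls)
    then have "seqnorm \<mu> (lincomb n c e) = 0"
      using cls_eq_iff[of "lincomb n c e" 0] mu_cauchy_lincomb[of n e c] e subspace_0[OF subspace]
      by simp
    then have "x = 0" using norm[OF x] by (simp add: lc seqnorm_const)
    moreover have "x j = (\<Sum>i<n. if i = j then c j else 0)"
      unfolding x_def lincomb_def sum_fun_apply by (intro sum.cong) (auto simp: unit_V_def)
    ultimately show ?thesis using j by simp
  qed
  then show "\<exists>e. (\<forall>i<n. e i \<in> Xmu \<mu>) \<and> (\<forall>c. xsum \<mu> n c e = xzero \<mu> \<longrightarrow> (\<forall>i<n. c i = 0))"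
    using e by (intro exI[of _ "\<lambda>i. cls (e i)"]) (auto simp: Xmu_eq)
qed

text \<open>The map \<open>constseq\<close> preserves sums, linear relations and the seminorm, so
  the dense criterion for its image translates back to \<open>Vset\<close>.\<close>

lemma octahedral_iff_V: "octahedral n \<longleftrightarrow> V_octahedral n \<mu>"
proof -
  have lc: "constseq x = lincomb n c (\<lambda>i. constseq (q i)) \<longleftrightarrow>
      ratvec x = lincomb n c (\<lambda>i. ratvec (q i))" for x c q
    by (simp add: constseq_def lincomb_def sum_fun_apply fun_eq_iff)
  have add: "constseq x + constseq r = constseq (\<lambda>i. x i + r i)" for x r
    by (simp add: constseq_def ratvec_add fun_eq_iff of_rat_add)
  have R: "(\<exists>r\<in>constseq ` Vset. \<bar>seqnorm \<mu> r - 1\<bar> < 1 / Suc k \<and>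
        (\<forall>x\<in>constseq ` F. seqnorm \<mu> x + 1 - 1 / Suc k < seqnorm \<mu> (x + r))) \<longleftrightarrow>
      (\<exists>r\<in>Vset. \<bar>\<mu> r - 1\<bar> < 1 / Suc k \<and> (\<forall>x\<in>F. \<mu> x + 1 - 1 / Suc k < \<mu> (\<lambda>i. x i + r i)))"
    if "F \<subseteq> Vset" for F k
    using that by (auto simp: seqnorm_constseq add Vset_add subset_iff)
  have Q: "(\<exists>q. (\<forall>i<n. q i \<in> constseq ` Vset) \<and> (\<forall>x\<in>constseq ` F. \<exists>c. x = lincomb n c q)) \<longleftrightarrow>
      (\<exists>q. (\<forall>i<n. q i \<in> Vset) \<and> (\<forall>x\<in>F. \<exists>c. ratvec x = lincomb n c (\<lambda>i. ratvec (q i))))"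
    (is "?L \<longleftrightarrow> ?R") for F
  proof
    assume ?L
    then obtain q where q: "\<forall>i<n. q i \<in> constseq ` Vset" "\<forall>x\<in>constseq ` F. \<exists>c. x = lincomb n c q"
      by blast
    from q(1) have "\<forall>i. \<exists>v. i < n \<longrightarrow> v \<in> Vset \<and> q i = constseq v" by blast
    then obtain v where v: "\<And>i. i < n \<Longrightarrow> v i \<in> Vset \<and> q i = constseq (v i)" by metis
    then have "lincomb n c q = lincomb n c (\<lambda>i. constseq (v i))" for c by (simp add: lincomb_def)
    then show ?R using q(2) v lc by (intro exI[of _ v]) auto
  next
    assume ?R
    then obtain v where "\<forall>i<n. v i \<in> Vset" "\<forall>x\<in>F. \<exists>c. ratvec x = lincomb n c (\<lambda>i. ratvec (v i))"
      by blast
    then show ?L by (intro exI[of _ "\<lambda>i. constseq (v i)"]) (auto simp: lc)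
  qed
  show ?thesis
    unfolding octahedral_iff_dense V_octahedral_def rank_family_def
  proof (intro iffI allI ballI impI; elim conjE CollectE)
    fix F k
    assume L: "\<forall>F (k::nat). finite F \<and> F \<subseteq> constseq ` Vset \<and>
        (\<exists>q. (\<forall>i<n. q i \<in> constseq ` Vset) \<and> (\<forall>x\<in>F. \<exists>c. x = lincomb n c q)) \<longrightarrow>
        (\<exists>r\<in>constseq ` Vset. \<bar>seqnorm \<mu> r - 1\<bar> < 1 / Suc k \<and>
          (\<forall>x\<in>F. seqnorm \<mu> x + 1 - 1 / Suc k < seqnorm \<mu> (x + r)))"
      and F: "finite F" "F \<subseteq> Vset"
      "\<exists>q. (\<forall>i<n. q i \<in> Vset) \<and> (\<forall>x\<in>F. \<exists>c. ratvec x = lincomb n c (\<lambda>i. ratvec (q i)))"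
    have "finite (constseq ` F)" "constseq ` F \<subseteq> constseq ` Vset" using F by auto
    with L[rule_format, of "constseq ` F" k, unfolded Q] F(3)
    show "\<exists>r\<in>Vset. \<bar>\<mu> r - 1\<bar> < 1 / Suc k \<and> (\<forall>x\<in>F. \<mu> x + 1 - 1 / Suc k < \<mu> (\<lambda>i. x i + r i))"
      unfolding R[OF F(2), symmetric] by simp
  next
    fix F k
    assume R': "\<forall>F\<in>{F. finite F \<and> F \<subseteq> Vset \<and>
        (\<exists>q. (\<forall>i<n. q i \<in> Vset) \<and> (\<forall>x\<in>F. \<exists>c. ratvec x = lincomb n c (\<lambda>i. ratvec (q i))))}.
        \<forall>k::nat. (\<exists>r\<in>Vset. \<bar>\<mu> r - 1\<bar> < 1 / Suc k \<and> (\<forall>x\<in>F. \<mu> x + 1 - 1 / Suc k < \<mu> (\<lambda>i. x i + r i)))"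
      and F: "finite F" "F \<subseteq> constseq ` Vset"
      "\<exists>q. (\<forall>i<n. q i \<in> constseq ` Vset) \<and> (\<forall>x\<in>F. \<exists>c. x = lincomb n c q)"
    obtain G where G: "G \<subseteq> Vset" "finite G" "F = constseq ` G"
      using finite_subset_image[OF F(1,2)] by blast
    from R'[rule_format, of G k] G(1,2) F(3)[unfolded G(3) Q]
    show "\<exists>r\<in>constseq ` Vset. \<bar>seqnorm \<mu> r - 1\<bar> < 1 / Suc k \<and>
          (\<forall>x\<in>F. seqnorm \<mu> x + 1 - 1 / Suc k < seqnorm \<mu> (x + r))"
      unfolding G(3) R[OF G(1)] by simp
  qed
qed

end

lemma OH_iff_V_octahedral: "seminorm_V \<mu> \<Longrightarrow> OH \<mu> \<longleftrightarrow> (\<forall>n. V_octahedral n \<mu>)"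
  using coded.OH_iff_octahedral[OF coded.intro] coded.octahedral_iff_V[OF coded.intro] by blast

lemma LOH_iff_V_octahedral: "seminorm_V \<mu> \<Longrightarrow> LOH \<mu> \<longleftrightarrow> V_octahedral 1 \<mu>"
  using coded.LOH_iff_octahedral[OF coded.intro] coded.octahedral_iff_V[OF coded.intro] by blast

section \<open>Both classes are G_delta\<close>

lemma countable_Vset: "countable Vset"
proof (rule countable_subset)
  show "Vset \<subseteq> range (\<lambda>xs i. if i < length xs then xs ! i else 0)"
  proof
    fix q assume "q \<in> Vset"
    then obtain N where N: "\<And>i. q i \<noteq> 0 \<Longrightarrow> i < N"
      unfolding Vset_def using finite_nat_set_iff_bounded by auto
    then have "q = (\<lambda>i. if i < length (map q [0..<N]) then map q [0..<N] ! i else 0)"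
      by (auto simp: fun_eq_iff)
    then show "q \<in> range (\<lambda>xs i. if i < length xs then xs ! i else 0)" by blast
  qed
qed simp

lemma gdelta_in_V_octahedral:
  assumes I: "I \<subseteq> topspace RV"
  shows "gdelta_in (subtopology RV I) {\<mu> \<in> I. V_octahedral n \<mu>}"
proof -
  define Z where "Z = subtopology RV I"
  have top: "topspace Z = I" using I by (auto simp: Z_def topspace_subtopology)
  have ev: "continuous_map Z euclideanreal (\<lambda>\<mu>. \<mu> q)" if "q \<in> Vset" for q
    unfolding Z_def RV_def
    using that by (intro continuous_map_from_subtopology
        continuous_map_product_projection[where X = "\<lambda>_. euclideanreal"])
  define U where "U F k = {\<mu> \<in> I. \<exists>r\<in>Vset. \<bar>\<mu> r - 1\<bar> < 1 / Suc k \<and>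
      (\<forall>x\<in>F. \<mu> x + 1 - 1 / Suc k < \<mu> (\<lambda>i. x i + r i))}" for F and k :: nat
  have openU: "openin Z (U F k)" if F: "finite F" "F \<subseteq> Vset" for F k
  proof -
    have "openin Z {\<mu> \<in> topspace Z. \<mu> r - 1 \<in> {- (1 / Suc k)<..<1 / Suc k}}" if "r \<in> Vset" for r
      using ev[OF that]
      by (intro openin_continuous_map_preimage[where Y = euclideanreal] continuous_map_diff) auto
    moreover have "openin Z {\<mu> \<in> topspace Z. \<mu> (\<lambda>i. x i + r i) - \<mu> x \<in> {1 - 1 / Suc k<..}}"
      if "r \<in> Vset" "x \<in> F" for r x
      using ev[OF Vset_add, of x r] ev[of x] that F(2)
      by (intro openin_continuous_map_preimage[where Y = euclideanreal] continuous_map_diff) auto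
    \<comment> \<open>Intersecting with the whole space matters for empty \<open>F\<close>, where
      the inner intersection is \<open>UNIV\<close>.\<close>
    ultimately have op: "openin Z ({\<mu> \<in> topspace Z. \<mu> r - 1 \<in> {- (1 / Suc k)<..<1 / Suc k}} \<inter>
        ((\<Inter>x\<in>F. {\<mu> \<in> topspace Z. \<mu> (\<lambda>i. x i + r i) - \<mu> x \<in> {1 - 1 / Suc k<..}}) \<inter> topspace Z))"
      if "r \<in> Vset" for r
      using F(1) that by (intro openin_Int openin_INT) auto
    have "U F k = (\<Union>r\<in>Vset. {\<mu> \<in> topspace Z. \<mu> r - 1 \<in> {- (1 / Suc k)<..<1 / Suc k}} \<inter>
        ((\<Inter>x\<in>F. {\<mu> \<in> topspace Z. \<mu> (\<lambda>i. x i + r i) - \<mu> x \<in> {1 - 1 / Suc k<..}}) \<inter> topspace Z))"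
      (is "_ = (\<Union>r\<in>Vset. ?O r)")
    proof (rule set_eqI)
      fix \<mu>
      have "\<mu> \<in> ?O r \<longleftrightarrow> \<mu> \<in> I \<and> \<bar>\<mu> r - 1\<bar> < 1 / Suc k \<and>
          (\<forall>x\<in>F. \<mu> x + 1 - 1 / Suc k < \<mu> (\<lambda>i. x i + r i))" for r
        unfolding abs_less_iff by (auto simp: top algebra_simps)
      then show "\<mu> \<in> U F k \<longleftrightarrow> \<mu> \<in> (\<Union>r\<in>Vset. ?O r)" by (auto simp: U_def)
    qed
    then show ?thesis using op by (auto intro!: openin_Union)
  qed
  have fam: "rank_family n \<subseteq> {F. finite F \<and> F \<subseteq> Vset}" by (auto simp: rank_family_def)
  have "{F. finite F \<and> F \<subseteq> Vset} = {F. F \<subseteq> Vset \<and> finite F}" by auto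
  then have cnt: "countable (rank_family n)"
    using countable_subset[OF fam] countable_Collect_finite_subset[OF countable_Vset] by auto
  \<comment> \<open>This keeps the index set nonempty: the intersection is then contained in
    \<open>I\<close> and is a genuine countable intersection of open sets.\<close>
  have empty: "{} \<in> rank_family n"
    by (auto simp: rank_family_def intro!: exI[of _ "\<lambda>_ _. 0"]) (simp add: Vset_def)
  have "{\<mu> \<in> I. V_octahedral n \<mu>} = (\<Inter>(F, k)\<in>rank_family n \<times> UNIV. U F k)"
    using empty by (auto simp: V_octahedral_def U_def)
  also have "gdelta_in Z \<dots>"
    using cnt empty fam
    by (intro gdelta_in_Inter) (auto intro!: open_imp_gdelta_in openU)
  finally show ?thesis by (simp add: Z_def)
qed

section \<open>A mixture of the sum norm and the supremum norm\<close>

text \<open>Indices in \<open>A\<close> contribute 0 instead of being omitted, so the supremum is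
  over a nonempty set even when \<open>A\<close> is everything.\<close>

definition off_sup :: "nat set \<Rightarrow> (nat \<Rightarrow> real) \<Rightarrow> real" where
  "off_sup A x = (SUP i. if i \<in> A then 0 else \<bar>x i\<bar>)"

text \<open>The norm of the l_1-sum of l_1 over \<open>A\<close> and c_0 over the complement. The
  c_0 summand keeps the space infinite-dimensional for finite \<open>A\<close> without supplying
  octahedral directions.\<close>

definition mixnorm :: "nat set \<Rightarrow> (nat \<Rightarrow> real) \<Rightarrow> real" where
  "mixnorm A x = (\<Sum>i\<in>{i. x i \<noteq> 0} \<inter> A. \<bar>x i\<bar>) + off_sup A x"

lemma bdd_above_coords: "x \<in> c00 \<Longrightarrow> bdd_above (range (\<lambda>i. if i \<in> A then 0 else \<bar>x i\<bar>))"
proof -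
  assume "x \<in> c00"
  moreover have "range (\<lambda>i. if i \<in> A then 0 else \<bar>x i\<bar>) \<subseteq> insert 0 ((\<lambda>i. \<bar>x i\<bar>) ` {i. x i \<noteq> 0})"
    by auto
  ultimately show ?thesis
    by (intro bdd_above_finite) (auto simp: c00_def intro: finite_subset)
qed

lemma coord_le_sup:
  "x \<in> c00 \<Longrightarrow> i \<notin> A \<Longrightarrow> \<bar>x i\<bar> \<le> off_sup A x"
  using cSUP_upper[OF UNIV_I bdd_above_coords[of x A], of i] by (simp only: off_sup_def if_False)

lemma sup_coords_nonneg:
  assumes "x \<in> c00"
  shows "0 \<le> off_sup A x"
proof -
  have "0 \<le> (if 0 \<in> A then 0 else \<bar>x 0\<bar>)" by simp
  also have "\<dots> \<le> off_sup A x"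
    unfolding off_sup_def by (rule cSUP_upper[OF UNIV_I bdd_above_coords[OF assms]])
  finally show ?thesis .
qed

lemma sup_coords_le:
  fixes x :: "nat \<Rightarrow> real"
  shows "0 \<le> M \<Longrightarrow> (\<And>i. i \<notin> A \<Longrightarrow> \<bar>x i\<bar> \<le> M) \<Longrightarrow> off_sup A x \<le> M"
  unfolding off_sup_def by (rule cSUP_least) auto

text \<open>The freedom in \<open>T\<close> allows one index set for several vectors, as the
  triangle inequality needs.\<close>

lemma mixnorm_eq:
  assumes "finite T" and "{i. x i \<noteq> 0} \<inter> A \<subseteq> T" and "T \<subseteq> A"
  shows "mixnorm A x = (\<Sum>i\<in>T. \<bar>x i\<bar>) + off_sup A x"
  unfolding mixnorm_def using assms by (auto intro!: sum.mono_neutral_left)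

text \<open>Off its support a vector contributes 0 to either part. This is why a code depends on
  only finitely many membership questions at each rational vector.\<close>

lemma mixnorm_cong:
  assumes "\<And>i. x i \<noteq> 0 \<Longrightarrow> i \<in> A \<longleftrightarrow> i \<in> B"
  shows "mixnorm A x = mixnorm B x"
proof -
  have "{i. x i \<noteq> 0} \<inter> A = {i. x i \<noteq> 0} \<inter> B" using assms by auto
  moreover have "(\<lambda>i. if i \<in> A then 0 else \<bar>x i\<bar>) = (\<lambda>i. if i \<in> B then 0 else \<bar>x i\<bar>)"
    using assms by (auto simp: fun_eq_iff)
  then have "off_sup A x = off_sup B x" by (simp only: off_sup_def)
  ultimately show ?thesis by (simp add: mixnorm_def)
qed

lemma coord_le_mixnorm:
  assumes x: "x \<in> c00"
  shows "\<bar>x i\<bar> \<le> mixnorm A x"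
proof (cases "i \<in> A \<and> x i \<noteq> 0")
  case True
  then have "\<bar>x i\<bar> \<le> (\<Sum>i\<in>{i. x i \<noteq> 0} \<inter> A. \<bar>x i\<bar>)"
    using x by (intro member_le_sum) (auto simp: c00_def)
  then show ?thesis using sup_coords_nonneg[OF x, of A] by (simp add: mixnorm_def)
next
  case False
  have "0 \<le> (\<Sum>i\<in>{i. x i \<noteq> 0} \<inter> A. \<bar>x i\<bar>)" by (rule sum_nonneg) auto
  moreover have "\<bar>x i\<bar> \<le> off_sup A x"
    using False coord_le_sup[OF x, of i A] sup_coords_nonneg[OF x, of A] by auto
  ultimately show ?thesis unfolding mixnorm_def by linarith
qed

lemma seminormed_mixnorm: "seminormed c00 (mixnorm A)"
proof
  show "subspace c00" by (rule subspace_c00)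
next
  fix x y :: "nat \<Rightarrow> real" assume x: "x \<in> c00" and y: "y \<in> c00"
  define T where "T = ({i. x i \<noteq> 0} \<union> {i. y i \<noteq> 0}) \<inter> A"
  have T: "finite T" "T \<subseteq> A" "{i. x i \<noteq> 0} \<inter> A \<subseteq> T" "{i. y i \<noteq> 0} \<inter> A \<subseteq> T"
    "{i. (x + y) i \<noteq> 0} \<inter> A \<subseteq> T"
    using x y by (auto simp: T_def c00_def)
  have "(\<Sum>i\<in>T. \<bar>(x + y) i\<bar>) \<le> (\<Sum>i\<in>T. \<bar>x i\<bar>) + (\<Sum>i\<in>T. \<bar>y i\<bar>)"
    unfolding sum.distrib[symmetric] by (rule sum_mono) auto
  moreover have "off_sup A (x + y) \<le>
      off_sup A x + off_sup A y"
  proof (rule sup_coords_le)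
    show "0 \<le> off_sup A x + off_sup A y"
      using sup_coords_nonneg[OF x] sup_coords_nonneg[OF y] by (rule add_nonneg_nonneg)
    fix i assume "i \<notin> A"
    from coord_le_sup[OF x this] coord_le_sup[OF y this]
    show "\<bar>(x + y) i\<bar> \<le> off_sup A x + off_sup A y"
      by simp
  qed
  ultimately show "mixnorm A (x + y) \<le> mixnorm A x + mixnorm A y"
    unfolding mixnorm_eq[OF T(1,3,2)] mixnorm_eq[OF T(1,4,2)] mixnorm_eq[OF T(1,5,2)] by linarith
next
  fix a :: real and x :: "nat \<Rightarrow> real" assume x: "x \<in> c00"
  show "mixnorm A (a *\<^sub>R x) = \<bar>a\<bar> * mixnorm A x"
  proof (cases "a = 0")
    case True
    have "off_sup A 0 = 0" unfolding off_sup_def by (simp only: zero_fun_apply abs_zero if_cancel) simp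
    then show ?thesis using True by (simp add: mixnorm_def)
  next
    case False
    have le: "off_sup A (b *\<^sub>R z) \<le> \<bar>b\<bar> * off_sup A z"
      if z: "z \<in> c00" for b and z :: "nat \<Rightarrow> real"
      using coord_le_sup[OF z, of _ A] sup_coords_nonneg[OF z, of A]
      by (intro sup_coords_le) (auto simp: abs_mult intro: mult_left_mono)
    have ax: "a *\<^sub>R x \<in> c00" using subspace_c00 x by (rule subspace_scale)
    \<comment> \<open>The reverse inequality is the proved one, applied to
      \<open>a *\<^sub>R x\<close> and the inverse scalar.\<close>
    have "inverse a *\<^sub>R a *\<^sub>R x = x" using False by simp
    then have "\<bar>a\<bar> * off_sup A x \<le>
        \<bar>a\<bar> * (\<bar>inverse a\<bar> * off_sup A (a *\<^sub>R x))"
      using le[OF ax, of "inverse a"] by (intro mult_left_mono) simp_all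
    also have "\<dots> = off_sup A (a *\<^sub>R x)"
      using False by (simp add: abs_inverse)
    finally have "off_sup A (a *\<^sub>R x) =
        \<bar>a\<bar> * off_sup A x" using le[OF x, of a] by linarith
    then show ?thesis
      using False by (simp add: mixnorm_def abs_mult sum_distrib_left distrib_left)
  qed
qed

text \<open>The restriction to \<open>Vset\<close> makes the function extensional, as membership in
  the product space \<open>RV\<close> requires.\<close>

definition mixmu :: "nat set \<Rightarrow> (nat \<Rightarrow> rat) \<Rightarrow> real" where
  "mixmu A = restrict (\<lambda>q. mixnorm A (ratvec q)) Vset"

lemma mixmu_apply: "q \<in> Vset \<Longrightarrow> mixmu A q = mixnorm A (ratvec q)"
  by (simp add: mixmu_def)

lemma seminorm_mixmu: "seminorm_V (mixmu A)"
proof -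
  interpret seminormed c00 "mixnorm A" by (rule seminormed_mixnorm)
  show ?thesis
    unfolding seminorm_V_def
    by (auto simp: mixmu_apply Vset_add Vset_scale ratvec_add ratvec_scale scale ratvec_c00
        intro!: triangle)
qed

text \<open>Both sides are limits of the same rational values, as \<open>mixnorm\<close> is itself
  continuous on a fixed finite support.\<close>

lemma mu_bar_mixmu:
  assumes x: "x \<in> c00"
  shows "mu_bar (mixmu A) x = mixnorm A x"
proof -
  interpret seminormed c00 "mixnorm A" by (rule seminormed_mixnorm)
  obtain a where a: "\<And>k. a k \<in> Vset" "\<And>k i. x i = 0 \<Longrightarrow> a k i = 0"
    "\<And>i. (\<lambda>k. of_rat (a k i)) \<longlonglongrightarrow> x i" using c00_approx_rat[OF x] by blast
  have fin: "finite {i. x i \<noteq> 0}" using x by (simp add: c00_def)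
  have "(\<lambda>k. mixmu A (a k)) \<longlonglongrightarrow> mu_bar (mixmu A) x"
    using a by (intro mu_bar_tendsto[OF seminorm_mixmu x fin]) auto
  then have "(\<lambda>k. mixnorm A (ratvec (a k))) \<longlonglongrightarrow> mu_bar (mixmu A) x"
    using a(1) by (simp add: mixmu_apply)
  moreover have "(\<lambda>k. mixnorm A (ratvec (a k))) \<longlonglongrightarrow> mixnorm A x"
  proof (rule Lim_null[THEN iffD2], rule Lim_null_comparison)
    show "(\<lambda>k. mixnorm A (x - ratvec (a k))) \<longlonglongrightarrow> 0"
      using a by (intro seminormed_c00_tendsto[OF seminormed_mixnorm fin]) auto
    show "\<forall>\<^sub>F k in sequentially. norm (mixnorm A (ratvec (a k)) - mixnorm A x) \<le> mixnorm A (x - ratvec (a k))"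
      using p_abs_diff_le[OF x ratvec_c00[OF a(1)]]
      by (intro always_eventually allI) (simp add: abs_minus_commute)
  qed
  ultimately show ?thesis by (rule LIMSEQ_unique)
qed

text \<open>Each coordinate is dominated by \<open>mixnorm\<close>, so the extension is definite for
  every \<open>A\<close>, and definiteness forces infinite dimension.\<close>

lemma mixmu_Bset: "mixmu A \<in> Bset"
proof -
  interpret coded "mixmu A" by (rule coded.intro[OF seminorm_mixmu])
  have zero: "x = 0" if "x \<in> c00" "mu_bar (mixmu A) x = 0" for x
    using coord_le_mixnorm[OF that(1), of _ A] that by (auto simp: mu_bar_mixmu fun_eq_iff)
  have "mixmu A \<in> topspace RV" by (simp add: RV_def mixmu_def)
  then show ?thesis
    using zero infinite_dim_if_norm[OF zero] seminorm_mixmu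
    by (auto simp: Bset_def Pinf_def Pset_def zero_fun_def)
qed

lemma V_octahedral_mixmu:
  assumes A: "infinite A"
  shows "V_octahedral n (mixmu A)"
  unfolding V_octahedral_def
proof (intro ballI allI)
  fix F and k :: nat assume "F \<in> rank_family n"
  then have F: "finite F" "F \<subseteq> Vset" by (auto simp: rank_family_def)
  then have "finite (\<Union>x\<in>F. {i. x i \<noteq> 0})" by (auto simp: Vset_def)
  then obtain a where a: "a \<in> A" "\<And>x. x \<in> F \<Longrightarrow> x a = 0"
    using A by (metis (mono_tags, lifting) UN_I finite_subset mem_Collect_eq subsetI)
  \<comment> \<open>As \<open>a\<close> lies in \<open>A\<close> and \<open>x\<close> vanishes
    there, the sum part grows by exactly 1 and the supremum part is unchanged. The tests hold with
    no error, whatever \<open>k\<close> is.\<close>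
  have key: "mixmu A (\<lambda>i. x i + unit_V a i) = mixmu A x + 1" if x: "x \<in> Vset" "x a = 0" for x
  proof -
    define T where "T = insert a {i. x i \<noteq> 0} \<inter> A"
    have T: "finite T" "T \<subseteq> A" "{i. ratvec x i \<noteq> 0} \<inter> A \<subseteq> T" "a \<in> T"
      "{i. (ratvec x + ratvec (unit_V a)) i \<noteq> 0} \<inter> A \<subseteq> T"
      using x a(1) by (auto simp: T_def Vset_def unit_V_def split: if_splits)
    have "(\<Sum>i\<in>T. \<bar>(ratvec x + ratvec (unit_V a)) i\<bar>) = (\<Sum>i\<in>T. \<bar>ratvec x i\<bar> + (if i = a then 1 else 0))"
      using x(2) by (intro sum.cong) (auto simp: unit_V_def)
    also have "\<dots> = (\<Sum>i\<in>T. \<bar>ratvec x i\<bar>) + 1" using T(1,4) by (simp add: sum.distrib)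
    finally have s: "(\<Sum>i\<in>T. \<bar>(ratvec x + ratvec (unit_V a)) i\<bar>) = (\<Sum>i\<in>T. \<bar>ratvec x i\<bar>) + 1" .
    have "(\<lambda>i. if i \<in> A then 0 else \<bar>(ratvec x + ratvec (unit_V a)) i\<bar>) =
        (\<lambda>i. if i \<in> A then 0 else \<bar>ratvec x i\<bar>)"
      using a(1) by (auto simp: fun_eq_iff unit_V_def)
    then have "off_sup A (ratvec x + ratvec (unit_V a)) = off_sup A (ratvec x)"
      by (simp only: off_sup_def)
    then have "mixnorm A (ratvec x + ratvec (unit_V a)) = mixnorm A (ratvec x) + 1"
      unfolding mixnorm_eq[OF T(1,3,2)] mixnorm_eq[OF T(1,5,2)] s by simp
    then show ?thesis using x(1) by (simp add: mixmu_apply Vset_add unit_V_Vset ratvec_add)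
  qed
  have "(\<lambda>i. 0) \<in> Vset" by (simp add: Vset_def)
  moreover have "mixmu A (\<lambda>i. 0 * unit_V 0 i) = \<bar>of_rat 0\<bar> * mixmu A (unit_V 0)"
    by (rule seminorm_V_scale[OF seminorm_mixmu unit_V_Vset])
  ultimately have "mixmu A (unit_V a) = 1" using key[of "\<lambda>i. 0"] by simp
  then show "\<exists>r\<in>Vset. \<bar>mixmu A r - 1\<bar> < 1 / Suc k \<and>
      (\<forall>x\<in>F. mixmu A x + 1 - 1 / Suc k < mixmu A (\<lambda>i. x i + r i))"
    using key a(2) F(2) unit_V_Vset[of a] by (intro bexI[of _ "unit_V a"]) (auto simp: subset_iff)
qed

text \<open>Testing against the indicator of \<open>A\<close> and one further coordinate \<open>b\<close>: in each coordinate a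
  vector \<open>r\<close> of norm about 1 can add to only one of \<open>\<bar>1 + r\<^sub>i\<bar>\<close> and \<open>\<bar>1 - r\<^sub>i\<bar>\<close>.\<close>
lemma not_V_octahedral_mixmu:
  assumes A: "finite A"
  shows "\<not> V_octahedral 1 (mixmu A)"
proof
  assume oct: "V_octahedral 1 (mixmu A)"
  obtain b where b: "b \<notin> A" using A ex_new_if_finite[OF infinite_UNIV_nat] by blast
  define x :: "nat \<Rightarrow> rat" where "x i = (if i \<in> insert b A then 1 else 0)" for i
  \<comment> \<open>The two tests at \<open>x\<close> and \<open>- x\<close> together force
    \<open>(2 * card A + 4) / Suc k\<close> above 1, which this \<open>k\<close> excludes.\<close>
  define k where "k = 2 * card A + 4"
  define M where "M = 1 + 1 / real (Suc k)"
  have x: "x \<in> Vset" using A by (intro Vset_finite_support[of "insert b A"]) (auto simp: x_def)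
  have x': "(\<lambda>i. - x i) \<in> Vset" using Vset_scale[OF x, of "-1"] by simp
  \<comment> \<open>Both signs are available in dimension one, so a single \<open>r\<close> must
    satisfy two opposing inequalities.\<close>
  have "{x, \<lambda>i. - x i} \<in> rank_family 1"
  proof -
    have "\<forall>y\<in>{x, \<lambda>i. - x i}. \<exists>c. ratvec y = lincomb 1 c (\<lambda>i. ratvec x)"
    proof (intro ballI)
      fix y assume "y \<in> {x, \<lambda>i. - x i}"
      then have "ratvec y = lincomb 1 (\<lambda>_. 1) (\<lambda>i. ratvec x) \<or> ratvec y = lincomb 1 (\<lambda>_. -1) (\<lambda>i. ratvec x)"
        by (auto simp: lincomb_def fun_eq_iff of_rat_minus)
      then show "\<exists>c. ratvec y = lincomb 1 c (\<lambda>i. ratvec x)" by blast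
    qed
    then show ?thesis
      unfolding rank_family_def using x x' by (intro CollectI conjI exI[of _ "\<lambda>_. x"]) auto
  qed
  from oct[unfolded V_octahedral_def, rule_format, OF this, of k]
  obtain r where r: "r \<in> Vset" "\<bar>mixmu A r - 1\<bar> < 1 / Suc k"
    "mixmu A x + 1 - 1 / Suc k < mixmu A (\<lambda>i. x i + r i)"
    "mixmu A (\<lambda>i. - x i) + 1 - 1 / Suc k < mixmu A (\<lambda>i. - x i + r i)" by auto
  have "mixmu A r \<le> M" using r(2) by (simp add: M_def)
  then have rM: "\<bar>of_rat (r i)\<bar> \<le> M" for i
    using coord_le_mixnorm[OF ratvec_c00[OF r(1)], of i A] r(1) by (simp add: mixmu_apply)
  have M: "M \<ge> 1" by (simp add: M_def)
  have ev: "mixmu A y = (\<Sum>i\<in>A. \<bar>of_rat (y i)\<bar>) + off_sup A (ratvec y)"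
    if "y \<in> Vset" for y
    using mixnorm_eq[of A "ratvec y" A] A that by (simp add: mixmu_apply)
  have ge: "card A + 1 \<le> mixmu A y" if "y \<in> Vset" "\<And>i. i \<in> insert b A \<Longrightarrow> \<bar>of_rat (y i) :: real\<bar> = 1" for y
    using coord_le_sup[OF ratvec_c00[OF that(1)] b] that by (simp add: ev)
  have x1: "card A + 1 \<le> mixmu A x" by (rule ge[OF x]) (auto simp: x_def)
  have x2: "card A + 1 \<le> mixmu A (\<lambda>i. - x i)" by (rule ge[OF x']) (auto simp: x_def of_rat_minus)
  define t :: real where "t = of_rat (r b)"
  have sup1: "off_sup A (ratvec (\<lambda>i. x i + r i)) \<le> max \<bar>1 + t\<bar> M"
    using rM M by (intro sup_coords_le) (auto simp: x_def t_def of_rat_add le_max_iff_disj)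
  have sup2: "off_sup A (ratvec (\<lambda>i. - x i + r i)) \<le> max \<bar>- 1 + t\<bar> M"
    using rM M by (intro sup_coords_le) (auto simp: x_def t_def of_rat_add of_rat_minus of_rat_diff le_max_iff_disj)
  have "(\<Sum>i\<in>A. \<bar>of_rat (x i + r i)\<bar>) + (\<Sum>i\<in>A. \<bar>of_rat (- x i + r i)\<bar>) \<le> (\<Sum>i\<in>A. 2 * M)"
    unfolding sum.distrib[symmetric]
  proof (rule sum_mono)
    fix i assume "i \<in> A"
    then have eq: "(of_rat (x i + r i) :: real) = 1 + of_rat (r i)"
      "(of_rat (- x i + r i) :: real) = - 1 + of_rat (r i)"
      by (simp_all add: x_def of_rat_add of_rat_diff)
    show "\<bar>of_rat (x i + r i) :: real\<bar> + \<bar>of_rat (- x i + r i)\<bar> \<le> 2 * M"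
      unfolding eq using rM[of i] M by linarith
  qed
  also have "\<dots> = 2 * M * card A" by simp
  finally have s: "(\<Sum>i\<in>A. \<bar>of_rat (x i + r i)\<bar>) + (\<Sum>i\<in>A. \<bar>of_rat (- x i + r i)\<bar>) \<le> 2 * M * card A" .
  \<comment> \<open>Only one of the two maxima can gain from the coordinate \<open>b\<close>. With
    \<open>M\<close> near 1 the supremum parts give about 3 in total, and the sum parts about
    \<open>2 * card A\<close>, one short of what the two tests demand.\<close>
  have "max \<bar>1 + t\<bar> M + max \<bar>- 1 + t\<bar> M \<le> 1 + 2 * M"
    using rM[of b] M unfolding t_def by (smt (verit))
  then have "mixmu A (\<lambda>i. x i + r i) + mixmu A (\<lambda>i. - x i + r i) \<le> 2 * M * card A + 1 + 2 * M"
    using ev[OF Vset_add[OF x r(1)]] ev[OF Vset_add[OF x' r(1)]] sup1 sup2 s by linarith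
  then have "2 * card A + 4 - 2 / Suc k < 2 * M * card A + 1 + 2 * M"
    using r(3,4) x1 x2 by linarith
  then have "1 < (2 * card A + 4) / Suc k" by (simp add: M_def algebra_simps add_divide_distrib)
  then show False by (simp add: k_def field_simps)
qed

section \<open>G-delta sets in zero-dimensional Polish spaces\<close>

lemma separable_metrizable_imp_second_countable:
  assumes "metrizable_space X" and "separable_space X"
  shows "second_countable X"
proof -
  obtain M d where "Metric_space M d" and X: "X = Metric_space.mtopology M d"
    using assms(1) by (auto simp: metrizable_space_def)
  then interpret Metric_space M d by simp
  obtain C where C: "countable C" "C \<subseteq> M" "mtopology closure_of C = M"
    using assms(2) by (auto simp: separable_space_def X)
  define \<B> where "\<B> = (\<lambda>(c, n). mball c (1 / real (Suc n))) ` (C \<times> UNIV)"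
  have "\<exists>V\<in>\<B>. x \<in> V \<and> V \<subseteq> U" if U: "openin mtopology U" "x \<in> U" for U x
  proof -
    obtain e where e: "e > 0" "mball x e \<subseteq> U" and xM: "x \<in> M"
      using U unfolding openin_mtopology by blast
    obtain n :: nat where n: "1 / Suc n < e / 2"
      using reals_Archimedean[of "e/2"] e(1) by (auto simp: inverse_eq_divide)
    have "\<forall>r>0. \<exists>y\<in>C. y \<in> mball x r" using C(3) xM unfolding metric_closure_of by blast
    moreover have "0 < 1 / real (Suc n)" by simp
    ultimately obtain c where c: "c \<in> C" "c \<in> mball x (1 / Suc n)" by blast
    have "x \<in> mball c (1 / Suc n)" using c xM C(2) by (auto simp: commute)
    moreover have "mball c (1 / Suc n) \<subseteq> mball x e"
    proof
      fix y assume y: "y \<in> mball c (1 / Suc n)"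
      have "d x y \<le> d x c + d c y" using y c(2) xM by (intro triangle) auto
      also have "\<dots> < e" using y c(2) n by auto
      finally show "y \<in> mball x e" using y xM by auto
    qed
    ultimately show ?thesis using c(1) e(2) by (auto simp: \<B>_def)
  qed
  moreover have "countable \<B>" using C(1) by (simp add: \<B>_def)
  moreover have "\<forall>V\<in>\<B>. openin mtopology V" by (auto simp: \<B>_def)
  ultimately show ?thesis unfolding X second_countable_def by blast
qed

text \<open>A countable basis reduces a cover of \<open>U\<close> by clopen sets to a countable one;
  finite differences of clopen sets are clopen, so it can be made disjoint.\<close>

lemma open_eq_disjoint_clopens:
  assumes "second_countable W" and zd: "zero_dimensional W" and U: "openin W U"
  shows "\<exists>K::nat \<Rightarrow> 'a set. (\<forall>j. openin W (K j) \<and> closedin W (K j)) \<and> disjoint_family K \<and> (\<Union>j. K j) = U"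
proof -
  obtain \<B> where \<B>: "countable \<B>" "\<And>V. V \<in> \<B> \<Longrightarrow> openin W V"
    "\<And>U x. openin W U \<Longrightarrow> x \<in> U \<Longrightarrow> \<exists>V\<in>\<B>. x \<in> V \<and> V \<subseteq> U"
    using assms(1) unfolding second_countable_def by metis
  define clo where "clo C \<longleftrightarrow> openin W C \<and> closedin W C \<and> C \<subseteq> U" for C
  \<comment> \<open>One clopen set is chosen for each basic set that fits into some clopen subset of
    \<open>U\<close>, so countably many suffice.\<close>
  define \<B>' where "\<B>' = {V \<in> \<B>. \<exists>C. clo C \<and> V \<subseteq> C}"
  have "\<forall>V\<in>\<B>'. \<exists>C. clo C \<and> V \<subseteq> C" by (simp add: \<B>'_def)
  then obtain h where h: "\<And>V. V \<in> \<B>' \<Longrightarrow> clo (h V) \<and> V \<subseteq> h V" by metis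
  \<comment> \<open>The empty set makes the family nonempty, hence enumerable by
    \<open>from_nat_into\<close>, even for empty \<open>U\<close>.\<close>
  define \<K> where "\<K> = insert {} (h ` \<B>')"
  have cnt: "countable \<K>" using \<B>(1) by (simp add: \<K>_def \<B>'_def)
  have clo: "clo C" if "C \<in> \<K>" for C using that h by (auto simp: \<K>_def clo_def)
  have "\<Union>\<K> = U"
  proof
    show "\<Union>\<K> \<subseteq> U" using clo by (auto simp: clo_def)
    show "U \<subseteq> \<Union>\<K>"
    proof
      fix x assume x: "x \<in> U"
      obtain C where C: "clo C" "x \<in> C" using zd U x unfolding zero_dimensional_def clo_def by metis
      then obtain V where V: "V \<in> \<B>" "x \<in> V" "V \<subseteq> C" using \<B>(3)[of C x] by (auto simp: clo_def)
      then have "V \<in> \<B>'" using C by (auto simp: \<B>'_def)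
      then show "x \<in> \<Union>\<K>" using h[of V] V(2) by (auto simp: \<K>_def)
    qed
  qed
  moreover have ne: "\<K> \<noteq> {}" by (simp add: \<K>_def)
  define L where "L = from_nat_into \<K>"
  have L: "range L = \<K>" unfolding L_def using range_from_nat_into[OF ne cnt] .
  then have Lclo: "clo (L j)" for j using clo by auto
  have "openin W (disjointed L j) \<and> closedin W (disjointed L j)" for j
    unfolding disjointed_def using Lclo
    by (auto simp: clo_def intro!: openin_diff closedin_diff closedin_Union openin_Union)
  ultimately show ?thesis
    using disjoint_family_disjointed[of L] UN_disjointed_eq[of L] L by (intro exI[of _ "disjointed L"]) auto
qed

text \<open>Each member of a decreasing sequence of open sets is cut into disjoint clopen pieces, so
  a point meets at most one piece per level. Lying in infinitely many pieces therefore means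
  reaching infinitely many levels, hence all of them.\<close>

lemma gdelta_eq_infinitely_many_clopens:
  assumes W: "Polish_space W" "zero_dimensional W" and B: "gdelta_in W B"
  shows "\<exists>C::nat \<Rightarrow> 'a set. (\<forall>k. openin W (C k) \<and> closedin W (C k)) \<and>
    B = {w \<in> topspace W. infinite {k. w \<in> C k}}"
proof -
  have sc: "second_countable W"
    using W(1) unfolding Polish_space_def
    by (auto intro: separable_metrizable_imp_second_countable completely_metrizable_imp_metrizable_space)
  obtain U where U: "\<And>n. openin W (U n)" "\<And>n. U (Suc n) \<subseteq> U n" "\<Inter>(range U) = B"
    using B unfolding gdelta_in_descending by metis
  have dec: "U n \<subseteq> U m" if "m \<le> n" for m n :: nat
    using U(2) that by (rule lift_Suc_antimono_le)
  have "\<forall>n. \<exists>K::nat \<Rightarrow> 'a set. (\<forall>j. openin W (K j) \<and> closedin W (K j)) \<and> disjoint_family K \<and> (\<Union>j. K j) = U n"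
    using open_eq_disjoint_clopens[OF sc W(2) U(1)] by blast
  then obtain K :: "nat \<Rightarrow> nat \<Rightarrow> 'a set"
    where K: "\<And>n j. openin W (K n j) \<and> closedin W (K n j)" "\<And>n. disjoint_family (K n)"
      "\<And>n. (\<Union>j. K n j) = U n" by metis
  define C where "C k = K (fst (prod_decode k)) (snd (prod_decode k))" for k
  have "w \<in> B \<longleftrightarrow> infinite {k. w \<in> C k}" if w: "w \<in> topspace W" for w
  proof
    assume "w \<in> B"
    then have "\<forall>n. \<exists>j. w \<in> K n j" using U(3) K(3) by blast
    then obtain j where j: "\<And>n. w \<in> K n (j n)" by metis
    have "inj (\<lambda>n. prod_encode (n, j n))" by (auto simp: inj_on_def)
    then have "infinite (range (\<lambda>n. prod_encode (n, j n)))" by (simp add: range_inj_infinite)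
    moreover have "range (\<lambda>n. prod_encode (n, j n)) \<subseteq> {k. w \<in> C k}" using j by (auto simp: C_def)
    ultimately show "infinite {k. w \<in> C k}" using finite_subset by blast
  next
    assume inf: "infinite {k. w \<in> C k}"
    show "w \<in> B"
    proof (rule ccontr)
      assume "w \<notin> B"
      then obtain m where m: "w \<notin> U m" using U(3) by blast
      \<comment> \<open>A point outside \<open>U m\<close> lies in no piece of level m or beyond. By
        disjointness the level determines the piece, so at most m indices remain.\<close>
      have "{k. w \<in> C k} \<subseteq> (\<lambda>n. prod_encode (n, THE j. w \<in> K n j)) ` {..<m}"
      proof
        fix k assume "k \<in> {k. w \<in> C k}"
        then have wk: "w \<in> K (fst (prod_decode k)) (snd (prod_decode k))" by (simp add: C_def)
        then have "w \<in> U (fst (prod_decode k))" using K(3) by blast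
        then have "fst (prod_decode k) < m" using m dec by (meson not_le subsetD)
        moreover have "(THE j. w \<in> K (fst (prod_decode k)) j) = snd (prod_decode k)"
          using wk K(2)[of "fst (prod_decode k)"]
          by (intro the_equality) (auto simp: disjoint_family_on_def)
        ultimately show "k \<in> (\<lambda>n. prod_encode (n, THE j. w \<in> K n j)) ` {..<m}"
          by (intro image_eqI[of _ _ "fst (prod_decode k)"]) auto
      qed
      then show False using inf finite_subset by blast
    qed
  qed
  then show ?thesis
    using K(1) gdelta_in_subset[OF B] by (intro exI[of _ C]) (auto simp: C_def)
qed

section \<open>The continuous reduction\<close>

lemma continuous_map_mixmu:
  assumes C: "\<And>k. openin W (C k)" "\<And>k. closedin W (C k)"
  shows "continuous_map W RV (\<lambda>w. mixmu {k. w \<in> C k})"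
  unfolding RV_def continuous_map_componentwise
proof (intro conjI ballI)
  show "(\<lambda>w. mixmu {k. w \<in> C k}) ` topspace W \<subseteq> extensional Vset"
    by (auto simp: mixmu_def)
next
  fix q assume q: "q \<in> Vset"
  have "openin W {w \<in> topspace W. mixmu {k. w \<in> C k} q \<in> U}" for U
  proof (subst openin_subopen, intro ballI)
    fix v assume v: "v \<in> {w \<in> topspace W. mixmu {k. w \<in> C k} q \<in> U}"
    \<comment> \<open>\<open>T\<close> fixes the answers to the finitely many membership questions
      in the support of \<open>q\<close>; closedness of \<open>C i\<close> makes negative answers
      open too. The value is locally constant, so preimages of arbitrary \<open>U\<close> are
      open.\<close>
    define T where "T = (\<Inter>i\<in>{i. q i \<noteq> 0}. if v \<in> C i then C i else topspace W - C i) \<inter> topspace W"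
    have "openin W T"
      unfolding T_def using q C by (intro openin_INT) (auto simp: Vset_def intro: openin_diff)
    moreover have "v \<in> T" using v by (auto simp: T_def)
    moreover have "mixmu {k. w \<in> C k} q = mixmu {k. v \<in> C k} q" if "w \<in> T" for w
    proof -
      have "w \<in> C i \<longleftrightarrow> v \<in> C i" if "q i \<noteq> 0" for i
        using \<open>w \<in> T\<close> that by (auto simp: T_def split: if_splits)
      then have "mixnorm {k. w \<in> C k} (ratvec q) = mixnorm {k. v \<in> C k} (ratvec q)"
        by (intro mixnorm_cong) auto
      then show ?thesis using q by (simp add: mixmu_apply)
    qed
    then have "T \<subseteq> {w \<in> topspace W. mixmu {k. w \<in> C k} q \<in> U}" using v by (auto simp: T_def)
    ultimately show "\<exists>T. openin W T \<and> v \<in> T \<and> T \<subseteq> {w \<in> topspace W. mixmu {k. w \<in> C k} q \<in> U}"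
      by blast
  qed
  then show "continuous_map W euclideanreal (\<lambda>w. mixmu {k. w \<in> C k} q)"
    by (simp add: continuous_map_def)
qed

theorem theorem6p2:
  fixes I :: "((nat \<Rightarrow> rat) \<Rightarrow> real) set"
  assumes "I \<in> {Pset, Pinf, Bset}"
  shows "Gdelta_complete_in TYPE('w) (subtopology RV I) {\<mu> \<in> I. LOH \<mu>}
       \<and> Gdelta_complete_in TYPE('w) (subtopology RV I) {\<mu> \<in> I. OH \<mu>}"
proof -
  have BI: "Bset \<subseteq> I" and IP: "I \<subseteq> Pset" using assms by (auto simp: Bset_def Pinf_def)
  have sn: "seminorm_V \<mu>" if "\<mu> \<in> I" for \<mu> using that IP by (auto simp: Pset_def)
  have I: "I \<subseteq> topspace RV" using IP by (auto simp: Pset_def)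
  have LOH_eq: "{\<mu> \<in> I. LOH \<mu>} = {\<mu> \<in> I. V_octahedral 1 \<mu>}"
    using LOH_iff_V_octahedral[OF sn] by auto
  have OH_eq: "{\<mu> \<in> I. OH \<mu>} = {\<mu> \<in> I. \<forall>n. V_octahedral n \<mu>}"
    using OH_iff_V_octahedral[OF sn] by auto
  have gLOH: "gdelta_in (subtopology RV I) {\<mu> \<in> I. LOH \<mu>}"
    unfolding LOH_eq by (rule gdelta_in_V_octahedral[OF I])
  have "{\<mu> \<in> I. OH \<mu>} = (\<Inter>n. {\<mu> \<in> I. V_octahedral n \<mu>})" unfolding OH_eq by auto
  then have gOH: "gdelta_in (subtopology RV I) {\<mu> \<in> I. OH \<mu>}"
    using gdelta_in_V_octahedral[OF I] by (auto intro!: gdelta_in_Inter)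
  \<comment> \<open>A single \<open>f\<close> reduces to both classes: the tests hold for every n
    when the index set is infinite and fail for n = 1 when it is finite.\<close>
  have red: "\<exists>f. continuous_map W (subtopology RV I) f \<and> B = {w \<in> topspace W. f w \<in> {\<mu> \<in> I. LOH \<mu>}} \<and>
      B = {w \<in> topspace W. f w \<in> {\<mu> \<in> I. OH \<mu>}}"
    if W: "Polish_space W" "zero_dimensional W" and B: "gdelta_in W B" for W :: "'w topology" and B
  proof -
    obtain C :: "nat \<Rightarrow> 'w set" where clopen: "\<forall>k. openin W (C k) \<and> closedin W (C k)"
      and BC: "B = {w \<in> topspace W. infinite {k. w \<in> C k}}"
      using gdelta_eq_infinitely_many_clopens[OF W B] by (elim exE conjE)
    define f where "f = (\<lambda>w. mixmu {k. w \<in> C k})"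
    have fI: "f w \<in> I" for w using mixmu_Bset BI by (auto simp: f_def)
    have "f w \<in> {\<mu> \<in> I. LOH \<mu>} \<longleftrightarrow> infinite {k. w \<in> C k}"
      "f w \<in> {\<mu> \<in> I. OH \<mu>} \<longleftrightarrow> infinite {k. w \<in> C k}" for w
      unfolding LOH_eq OH_eq using fI[of w] V_octahedral_mixmu not_V_octahedral_mixmu
      by (auto simp: f_def)
    moreover have "continuous_map W (subtopology RV I) f"
      unfolding continuous_map_in_subtopology using continuous_map_mixmu[of W C] clopen fI
      by (auto simp: f_def)
    ultimately show ?thesis using BC by (intro exI[of _ f]) simp
  qed
  show ?thesis
    unfolding Gdelta_complete_in_def
  proof (intro conjI allI impI gLOH gOH; elim conjE)
    fix W :: "'w topology" and B
    assume W: "Polish_space W" "zero_dimensional W" "gdelta_in W B"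
    from red[OF this] obtain f where f: "continuous_map W (subtopology RV I) f"
      "B = {w \<in> topspace W. f w \<in> {\<mu> \<in> I. LOH \<mu>}}"
      "B = {w \<in> topspace W. f w \<in> {\<mu> \<in> I. OH \<mu>}}" by (elim exE conjE)
    show "\<exists>f. continuous_map W (subtopology RV I) f \<and> B = {w \<in> topspace W. f w \<in> {\<mu> \<in> I. LOH \<mu>}}"
      by (intro exI[of _ f] conjI f)
    show "\<exists>f. continuous_map W (subtopology RV I) f \<and> B = {w \<in> topspace W. f w \<in> {\<mu> \<in> I. OH \<mu>}}"
      by (intro exI[of _ f] conjI f)
  qed
qed

end
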